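(* Let $p\in\mathbb C$, $p\neq0$, and $\Delta,\alpha\in\mathbb C$. (1) The $\mathfrak K(p)$-module $V^{(1)}_{\Delta,\alpha}$ is simple if and only if $\Delta\neq0$. Furthermore, $V^{(1)}_{0,\alpha}$ contains a unique nontrivial (i.e. nonzero proper) submodule $\mathbb C[\partial](\partial+\alpha)v_{\bar0}\oplus\mathbb C[\partial](\frac12v_{\bar1})\cong\widetilde{V^{(2)}_{\frac12,\alpha}}$, and the quotient is an even trivial module $\mathbb Cc_{-\alpha}$. (2) The $\mathfrak K(p)$-module $V^{(2)}_{\Delta,\alpha}$ is simple if and only if $\Delta\ne0$. Furthermore, $V^{(2)}_{0,\alpha}$ contains a unique nontrivial submodule $\mathbb C[\partial](\partial+\alpha)v_{\bar0}\oplus\mathbb C[\partial](\frac12v_{\bar1})\cong\widetilde{V^{(1)}_{\frac12,\alpha}}$, and the quotient is an even trivial module $\mathbb Cc_{-\alpha}$. In addition, the same holds with the parity of all $\mathfrak K(p)$-modules reversed, that is: $\widetilde{V^{(1)}_{\Delta,\alpha}}$ is simple if and only if $\Delta\neq0$, and $\widetilde{V^{(1)}_{0,\alpha}}$ contains a unique nontrivial submodule, namely $\mathbb C[\partial](\partial+\alpha)v_{\bar0}\oplus\mathbb C[\partial](\frac12v_{\bar1})$ with reversed parity, which is isomorphic to $V^{(2)}_{\frac12,\alpha}$, and the quotient is the odd trivial module $\widetilde{\mathbb Cc_{-\alpha}}$; likewise, $\widetilde{V^{(2)}_{\Delta,\alpha}}$ is simple if and only if $\Delta\neq0$, and $\widetilde{V^{(2)}_{0,\alpha}}$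 contains a unique nontrivial submodule, namely $\mathbb C[\partial](\partial+\alpha)v_{\bar0}\oplus\mathbb C[\partial](\frac12v_{\bar1})$ with reversed parity, which is isomorphic to $V^{(1)}_{\frac12,\alpha}$, and the quotient is the odd trivial module $\widetilde{\mathbb Cc_{-\alpha}}$.
   Context: A Lie conformal superalgebra is a $\mathbb Z/2\mathbb Z$-graded $\mathbb C[\partial]$-module $R=R_{\bar0}\oplus R_{\bar1}$ with a (parity-preserving) $\mathbb C$-linear $\lambda$-bracket $R\otimes R\to\mathbb C[\lambda]\otimes R$, $a\otimes b\mapsto[a\,{}_\lambda\, b]$, such that $[\partial a\,{}_\lambda\, b]=-\lambda[a\,{}_\lambda\, b]$, $[a\,{}_\lambda\,\partial b]=(\partial+\lambda)[a\,{}_\lambda\, b]$, $[a\,{}_\lambda\, b]=-(-1)^{|a||b|}[b\,{}_{-\lambda-\partial}\,a]$, $[a\,{}_\lambda[b\,{}_\mu c]]=[[a\,{}_\lambda b]\,{}_{\lambda+\mu}c]+(-1)^{|a||b|}[b\,{}_\mu[a\,{}_\lambda c]]$. A conformal $R$-module is a $\mathbb Z/2\mathbb Z$-graded $\mathbb C[\partial]$-module $M=M_{\bar0}\oplus M_{\bar1}$ with a (parity-preserving) $\mathbb C$-linear $\lambda$-action $R\otimes M\to\mathbb C[\lambda]\otimes M$, $a\otimes v\mapsto a\,{}_\lambda v$, such that $(\partial a)\,{}_\lambda v=-\lambda\, a\,{}_\lambda v$, $a\,{}_\lambda(\partial v)=(\partial+\lambda)a\,{}_\lambda v$, $[a\,{}_\lambda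 b]\,{}_{\lambda+\mu}v=a\,{}_\lambda(b\,{}_\mu v)-(-1)^{|a||b|}b\,{}_\mu(a\,{}_\lambda v)$. $\widetilde M$ denotes the module $M$ with reversed parity. For $\gamma\in\mathbb C$, $\mathbb Cc_\gamma$ is the even one-dimensional trivial module: $|c_\gamma|=\bar0$, $\partial c_\gamma=\gamma c_\gamma$, and $R$ acts as zero. For nonzero $p\in\mathbb C$, $\mathfrak K(p)$ is the Lie conformal superalgebra whose even part has $\mathbb C[\partial]$-basis $\{L_i,J_i\mid i\in\mathbb Z_+\}$ and odd part has $\mathbb C[\partial]$-basis $\{G_i^\pm\mid i\in\mathbb Z_+\}$ ($\mathbb Z_+=\{0,1,2,\dots\}$), with $[L_i\,{}_\lambda L_j]=((i+p)\partial+(i+j+2p)\lambda)L_{i+j}$, $[L_i\,{}_\lambda J_j]=((i+p)\partial+(i+j+p)\lambda)J_{i+j}$, $[L_i\,{}_\lambda G^\pm_j]=((i+p)\partial+(i+j+\frac32p)\lambda)G^\pm_{i+j}$, $[J_i\,{}_\lambda G^\pm_j]=\pm G^\pm_{i+j}$, $[G^+_i\,{}_\lambda G^-_j]=((2i+p)\partial+2(i+j+p)\lambda)J_{i+j}+2L_{i+j}$, the other brackets of basis elements being given by skew-symmetry or zero. Fix a square root $\sqrt p$ of $p$. For $\Delta,\alpha\in\mathbb C$ (subscripts $\bar0,\bar1$ denote parity): $V^{(1)}_{\Delta,\alpha}=\mathbb C[\partial]v_{\bar0}\oplus\mathbb C[\partial]v_{\bar1}$ (free): $L_0\,{}_\lambda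 v_{\bar0}=p(\partial+\Delta\lambda+\alpha)v_{\bar0}$, $L_0\,{}_\lambda v_{\bar1}=p(\partial+(\Delta+\frac12)\lambda+\alpha)v_{\bar1}$, $J_0\,{}_\lambda v_{\bar0}=-2\Delta v_{\bar0}$, $J_0\,{}_\lambda v_{\bar1}=(1-2\Delta)v_{\bar1}$, $G_0^+\,{}_\lambda v_{\bar0}=\sqrt p\,v_{\bar1}$, $G_0^+\,{}_\lambda v_{\bar1}=0$, $G_0^-\,{}_\lambda v_{\bar0}=0$, $G_0^-\,{}_\lambda v_{\bar1}=2\sqrt p(\partial+2\Delta\lambda+\alpha)v_{\bar0}$; $L_i,J_i,G_i^\pm$ act as zero for $i\ge1$. $V^{(2)}_{\Delta,\alpha}=\mathbb C[\partial]v_{\bar0}\oplus\mathbb C[\partial]v_{\bar1}$ (free): $L_0\,{}_\lambda v_{\bar0}=p(\partial+\Delta\lambda+\alpha)v_{\bar0}$, $L_0\,{}_\lambda v_{\bar1}=p(\partial+(\Delta+\frac12)\lambda+\alpha)v_{\bar1}$, $J_0\,{}_\lambda v_{\bar0}=2\Delta v_{\bar0}$, $J_0\,{}_\lambda v_{\bar1}=(2\Delta-1)v_{\bar1}$, $G_0^+\,{}_\lambda v_{\bar0}=0$, $G_0^+\,{}_\lambda v_{\bar1}=2\sqrt p(\partial+2\Delta\lambda+\alpha)v_{\bar0}$, $G_0^-\,{}_\lambda v_{\bar0}=\sqrt p\,v_{\bar1}$, $G_0^-\,{}_\lambda v_{\bar1}=0$; $L_i,J_i,G_i^\pm$ act as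 zero for $i\ge1$. *)

theory Defs
  imports
    "HOL-Algebra.Algebraic_Closure_Type"
    "HOL-Library.Poly_Mapping"
    "HOL-Library.Z2"
begin

text \<open>The ring \<open>\<complex>[\<partial>]\<close>; the indeterminate \<open>\<partial>\<close> is \<open>[:0, 1:]\<close>.\<close>

abbreviation cdel :: "complex poly ring" where
  "cdel \<equiv> ring_of_type_algebra"

text \<open>
  One record type serves both for algebras and for modules: a \<open>\<complex>[\<partial>]\<close>-module together with its
  homogeneous components and a \<open>\<lambda>\<close>-action of \<open>'r\<close>.  An element of \<open>\<complex>[\<lambda>] \<otimes> M\<close> is represented by
  its (finitely supported) sequence of coefficients, so \<open>a\<^sub>\<lambda>v = \<Sum>\<^sub>n \<lambda>\<^sup>n (act M a v n)\<close>.  For an algebra,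
  \<open>'m = 'r\<close> and \<open>act\<close> is the \<open>\<lambda>\<close>-bracket.  The fields \<open>mult\<close> and \<open>one\<close> which HOL-Algebra modules
  inherit from rings carry no information.
\<close>

record ('r, 'm) lam_module = "(complex poly, 'm) module" +
  part :: "bit \<Rightarrow> 'm set"
  act :: "'r \<Rightarrow> 'm \<Rightarrow> nat \<Rightarrow> 'm"

text \<open>
  \<open>lam_eval M f s\<close> substitutes \<open>s \<in> \<complex>[\<partial>]\<close> for \<open>\<lambda>\<close> in \<open>\<Sum>\<^sub>n \<lambda>\<^sup>n f n\<close>, the powers of \<open>s\<close> being placed
  to the left of the coefficients.  The identities in \<open>\<complex>[\<lambda>] \<otimes> M\<close> and \<open>\<complex>[\<lambda>, \<mu>] \<otimes> M\<close> below are
  stated for all complex values \<open>l\<close>, \<open>m\<close> of \<open>\<lambda>\<close>, \<open>\<mu>\<close>; since \<open>\<complex>\<close> is infinite, this is the same as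
  the identity of polynomials.
\<close>

definition lam_eval :: "('r, 'm) lam_module \<Rightarrow> (nat \<Rightarrow> 'm) \<Rightarrow> complex poly \<Rightarrow> 'm" where
  "lam_eval M f s = (\<Oplus>\<^bsub>M\<^esub> n \<in> {n. f n \<noteq> \<zero>\<^bsub>M\<^esub>}. (s ^ n) \<odot>\<^bsub>M\<^esub> f n)"

text \<open>The sign \<open>(-1)\<^bsup>ij\<^esup>\<close>.\<close>

definition koszul :: "bit \<Rightarrow> bit \<Rightarrow> complex" where
  "koszul i j = (if i = 1 \<and> j = 1 then - 1 else 1)"

locale super_module = module cdel M for M :: "('r, 'm) lam_module" (structure) +
  assumes part_submodule: "submodule (part M i) cdel M"
    and part_sum: "part M 0 <+> part M 1 = carrier M"
    and part_Int: "part M 0 \<inter> part M 1 = {\<zero>}"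

text \<open>The conditions shared by \<open>\<lambda>\<close>-brackets (\<open>M = R\<close>) and \<open>\<lambda>\<close>-actions.\<close>

locale lambda_product = R: super_module R + M: super_module M
  for R :: "('r, 'r) lam_module" and M :: "('r, 'm) lam_module" +
  assumes act_closed:
      "\<lbrakk>a \<in> carrier R; v \<in> carrier M\<rbrakk> \<Longrightarrow> act M a v n \<in> carrier M"
    and act_finite:
      "\<lbrakk>a \<in> carrier R; v \<in> carrier M\<rbrakk> \<Longrightarrow> finite {n. act M a v n \<noteq> \<zero>\<^bsub>M\<^esub>}"
    and act_add_left:
      "\<lbrakk>a \<in> carrier R; b \<in> carrier R; v \<in> carrier M\<rbrakk> \<Longrightarrow>
        act M (a \<oplus>\<^bsub>R\<^esub> b) v n = act M a v n \<oplus>\<^bsub>M\<^esub> act M b v n"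
    and act_add_right:
      "\<lbrakk>a \<in> carrier R; v \<in> carrier M; w \<in> carrier M\<rbrakk> \<Longrightarrow>
        act M a (v \<oplus>\<^bsub>M\<^esub> w) n = act M a v n \<oplus>\<^bsub>M\<^esub> act M a w n"
    and act_scale_left:
      "\<lbrakk>a \<in> carrier R; v \<in> carrier M\<rbrakk> \<Longrightarrow>
        act M ([:c:] \<odot>\<^bsub>R\<^esub> a) v n = [:c:] \<odot>\<^bsub>M\<^esub> act M a v n"
    and act_scale_right:
      "\<lbrakk>a \<in> carrier R; v \<in> carrier M\<rbrakk> \<Longrightarrow>
        act M a ([:c:] \<odot>\<^bsub>M\<^esub> v) n = [:c:] \<odot>\<^bsub>M\<^esub> act M a v n"
    and act_parity:
      "\<lbrakk>a \<in> part R i; v \<in> part M j\<rbrakk> \<Longrightarrow> act M a v n \<in> part M (i + j)"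
    and act_del_left:
      "\<lbrakk>a \<in> carrier R; v \<in> carrier M\<rbrakk> \<Longrightarrow>
        lam_eval M (act M ([:0, 1:] \<odot>\<^bsub>R\<^esub> a) v) [:l:] = [:- l:] \<odot>\<^bsub>M\<^esub> lam_eval M (act M a v) [:l:]"
    and act_del_right:
      "\<lbrakk>a \<in> carrier R; v \<in> carrier M\<rbrakk> \<Longrightarrow>
        lam_eval M (act M a ([:0, 1:] \<odot>\<^bsub>M\<^esub> v)) [:l:] =
          ([:0, 1:] + [:l:]) \<odot>\<^bsub>M\<^esub> lam_eval M (act M a v) [:l:]"

locale lie_conformal_superalgebra = lambda_product R R for R :: "('r, 'r) lam_module" +
  assumes skew_symmetry:
      "\<lbrakk>a \<in> part R i; b \<in> part R j\<rbrakk> \<Longrightarrow>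
        lam_eval R (act R a b) [:l:] =
          [:- koszul i j:] \<odot>\<^bsub>R\<^esub> lam_eval R (act R b a) (- [:l:] - [:0, 1:])"
    and jacobi:
      "\<lbrakk>a \<in> part R i; b \<in> part R j; c \<in> carrier R\<rbrakk> \<Longrightarrow>
        lam_eval R (act R a (lam_eval R (act R b c) [:m:])) [:l:] =
          lam_eval R (act R (lam_eval R (act R a b) [:l:]) c) [:l + m:] \<oplus>\<^bsub>R\<^esub>
          [:koszul i j:] \<odot>\<^bsub>R\<^esub> lam_eval R (act R b (lam_eval R (act R a c) [:l:])) [:m:]"

locale conformal_module = R: lie_conformal_superalgebra R + lambda_product R M
  for R :: "('r, 'r) lam_module" and M :: "('r, 'm) lam_module" +
  assumes act_bracket:
      "\<lbrakk>a \<in> part R i; b \<in> part R j; v \<in> carrier M\<rbrakk> \<Longrightarrow>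
        lam_eval M (act M (lam_eval R (act R a b) [:l:]) v) [:l + m:] =
          lam_eval M (act M a (lam_eval M (act M b v) [:m:])) [:l:] \<ominus>\<^bsub>M\<^esub>
          [:koszul i j:] \<odot>\<^bsub>M\<^esub> lam_eval M (act M b (lam_eval M (act M a v) [:l:])) [:m:]"

locale conformal_submodule = conformal_module R M + submodule N cdel M
  for R :: "('r, 'r) lam_module" and M :: "('r, 'm) lam_module" and N :: "'m set" +
  assumes graded: "(N \<inter> part M 0) <+>\<^bsub>M\<^esub> (N \<inter> part M 1) = N"
    and act_invariant: "\<lbrakk>a \<in> carrier R; v \<in> N\<rbrakk> \<Longrightarrow> act M a v n \<in> N"

definition nontrivial_submodule ::
    "('r, 'r) lam_module \<Rightarrow> ('r, 'm) lam_module \<Rightarrow> 'm set \<Rightarrow> bool" where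
  "nontrivial_submodule R M N \<longleftrightarrow>
     conformal_submodule R M N \<and> N \<noteq> {\<zero>\<^bsub>M\<^esub>} \<and> N \<noteq> carrier M"

definition simple_module :: "('r, 'r) lam_module \<Rightarrow> ('r, 'm) lam_module \<Rightarrow> bool" where
  "simple_module R M \<longleftrightarrow>
     conformal_module R M \<and> carrier M \<noteq> {\<zero>\<^bsub>M\<^esub>} \<and> (\<nexists>N. nontrivial_submodule R M N)"

definition submod :: "('r, 'm) lam_module \<Rightarrow> 'm set \<Rightarrow> ('r, 'm) lam_module" where
  "submod M N = M\<lparr>carrier := N, part := (\<lambda>i. N \<inter> part M i)\<rparr>"

definition quotmod :: "('r, 'm) lam_module \<Rightarrow> 'm set \<Rightarrow> ('r, 'm set) lam_module" where
  "quotmod M N =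
    \<lparr>carrier = a_rcosets\<^bsub>M\<^esub> N, monoid.mult = undefined, one = undefined,
     zero = N, add = set_add M,
     module.smult = (\<lambda>f Y. \<Union>x\<in>Y. N +>\<^bsub>M\<^esub> (f \<odot>\<^bsub>M\<^esub> x)),
     part = (\<lambda>i. (\<lambda>x. N +>\<^bsub>M\<^esub> x) ` part M i),
     act = (\<lambda>a Y n. \<Union>x\<in>Y. N +>\<^bsub>M\<^esub> act M a x n)\<rparr>"

definition parity_rev :: "('r, 'm) lam_module \<Rightarrow> ('r, 'm) lam_module" where
  "parity_rev M = M\<lparr>part := (\<lambda>i. part M (i + 1))\<rparr>"

text \<open>Homomorphisms are required to preserve parity.\<close>

locale conformal_hom = M: conformal_module R M + M': conformal_module R M'
  for R :: "('r, 'r) lam_module" and M :: "('r, 'm) lam_module" and M' :: "('r, 'n) lam_module" +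
  fixes \<phi> :: "'m \<Rightarrow> 'n"
  assumes hom_closed: "v \<in> carrier M \<Longrightarrow> \<phi> v \<in> carrier M'"
    and hom_add: "\<lbrakk>v \<in> carrier M; w \<in> carrier M\<rbrakk> \<Longrightarrow> \<phi> (v \<oplus>\<^bsub>M\<^esub> w) = \<phi> v \<oplus>\<^bsub>M'\<^esub> \<phi> w"
    and hom_smult: "v \<in> carrier M \<Longrightarrow> \<phi> (f \<odot>\<^bsub>M\<^esub> v) = f \<odot>\<^bsub>M'\<^esub> \<phi> v"
    and hom_parity: "v \<in> part M i \<Longrightarrow> \<phi> v \<in> part M' i"
    and hom_act: "\<lbrakk>a \<in> carrier R; v \<in> carrier M\<rbrakk> \<Longrightarrow> \<phi> (act M a v n) = act M' a (\<phi> v) n"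

definition module_iso ::
    "('r, 'r) lam_module \<Rightarrow> ('r, 'm) lam_module \<Rightarrow> ('r, 'n) lam_module \<Rightarrow> bool" where
  "module_iso R M M' \<longleftrightarrow> (\<exists>\<phi>. conformal_hom R M M' \<phi> \<and> bij_betw \<phi> (carrier M) (carrier M'))"

definition cyclic_span :: "('r, 'm) lam_module \<Rightarrow> 'm \<Rightarrow> 'm set" where
  "cyclic_span M v = {f \<odot>\<^bsub>M\<^esub> v | f. True}"

definition trivial_module :: "complex \<Rightarrow> ('r, complex) lam_module" where
  "trivial_module \<gamma> =
    \<lparr>carrier = UNIV, monoid.mult = undefined, one = undefined, zero = 0, add = (+),
     module.smult = (\<lambda>f z. poly f \<gamma> * z),
     part = (\<lambda>i. if i = 0 then UNIV else {0}),
     act = (\<lambda>a z n. 0)\<rparr>"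

text \<open>
  The elements of \<open>\<complex>[\<lambda>, \<partial>]\<close> are polynomials in \<open>\<lambda>\<close> with coefficients in \<open>\<complex>[\<partial>]\<close>.
\<close>

abbreviation Lam :: "complex poly poly" where "Lam \<equiv> [:0, 1:]"
abbreviation Del :: "complex poly poly" where "Del \<equiv> [:[:0, 1:]:]"
abbreviation Cst :: "complex \<Rightarrow> complex poly poly" where "Cst c \<equiv> [:[:c:]:]"

text \<open>\<open>f(q) \<in> \<complex>[\<lambda>, \<partial>]\<close> for \<open>f \<in> \<complex>[\<partial>]\<close> and \<open>q \<in> \<complex>[\<lambda>, \<partial>]\<close>.\<close>

definition subst_del :: "complex poly \<Rightarrow> complex poly poly \<Rightarrow> complex poly poly" where
  "subst_del f q = poly (map_poly Cst f) q"

text \<open>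
  The free \<open>\<complex>[\<partial>]\<close>-module with basis \<open>'b\<close>, where basis vectors have parity \<open>par\<close> and the action of
  the free module with basis \<open>'a\<close> is determined by \<open>S a b = a\<^sub>\<lambda>b\<close> on basis vectors and
  extended by sesquilinearity: \<open>(f(\<partial>)a)\<^sub>\<lambda>(g(\<partial>)b) = f(-\<lambda>) g(\<partial>+\<lambda>) (a\<^sub>\<lambda>b)\<close>.
\<close>

definition free_lam_module ::
    "('b \<Rightarrow> bit) \<Rightarrow> ('a \<Rightarrow> 'b \<Rightarrow> ('b \<Rightarrow>\<^sub>0 complex poly poly)) \<Rightarrow>
      ('a \<Rightarrow>\<^sub>0 complex poly, 'b \<Rightarrow>\<^sub>0 complex poly) lam_module" where
  "free_lam_module par S =
    \<lparr>carrier = UNIV, monoid.mult = undefined, one = undefined, zero = 0, add = (+),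
     module.smult = (\<lambda>f. Poly_Mapping.map (\<lambda>g. f * g)),
     part = (\<lambda>i. {x. \<forall>b\<in>Poly_Mapping.keys x. par b = i}),
     act = (\<lambda>x v n. \<Sum>a\<in>Poly_Mapping.keys x. \<Sum>b\<in>Poly_Mapping.keys v.
       Poly_Mapping.map
         (\<lambda>q. Polynomial.coeff
                (subst_del (Poly_Mapping.lookup x a) (- Lam) *
                 subst_del (Poly_Mapping.lookup v b) (Del + Lam) * q) n)
         (S a b))\<rparr>"

datatype kgen = L nat | J nat | Gp nat | Gm nat

fun kgen_parity :: "kgen \<Rightarrow> bit" where
  "kgen_parity (L i) = 0"
| "kgen_parity (J i) = 0"
| "kgen_parity (Gp i) = 1"
| "kgen_parity (Gm i) = 1"

fun kbracket0 :: "complex \<Rightarrow> kgen \<Rightarrow> kgen \<Rightarrow> (kgen \<Rightarrow>\<^sub>0 complex poly poly)" where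
  "kbracket0 p (L i) (L j) = Poly_Mapping.single (L (i + j))
     (Cst (of_nat i + p) * Del + Cst (of_nat i + of_nat j + 2 * p) * Lam)"
| "kbracket0 p (L i) (J j) = Poly_Mapping.single (J (i + j))
     (Cst (of_nat i + p) * Del + Cst (of_nat i + of_nat j + p) * Lam)"
| "kbracket0 p (L i) (Gp j) = Poly_Mapping.single (Gp (i + j))
     (Cst (of_nat i + p) * Del + Cst (of_nat i + of_nat j + 3 / 2 * p) * Lam)"
| "kbracket0 p (L i) (Gm j) = Poly_Mapping.single (Gm (i + j))
     (Cst (of_nat i + p) * Del + Cst (of_nat i + of_nat j + 3 / 2 * p) * Lam)"
| "kbracket0 p (J i) (Gp j) = Poly_Mapping.single (Gp (i + j)) 1"
| "kbracket0 p (J i) (Gm j) = Poly_Mapping.single (Gm (i + j)) (- 1)"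
| "kbracket0 p (Gp i) (Gm j) =
     Poly_Mapping.single (J (i + j))
       (Cst (2 * of_nat i + p) * Del + Cst (2 * (of_nat i + of_nat j + p)) * Lam) +
     Poly_Mapping.single (L (i + j)) 2"
| "kbracket0 p _ _ = 0"

text \<open>\<open>-(-1)\<^bsup>|a||b|\<^esup> [b\<^bsub>-\<lambda>-\<partial>\<^esub> a]\<close>, computed from the table above.\<close>

definition kbracket_skew :: "complex \<Rightarrow> kgen \<Rightarrow> kgen \<Rightarrow> (kgen \<Rightarrow>\<^sub>0 complex poly poly)" where
  "kbracket_skew p a b =
     Poly_Mapping.map
       (\<lambda>q. - Cst (koszul (kgen_parity a) (kgen_parity b)) * pcompose q (- Lam - Del))
       (kbracket0 p b a)"

fun kbracket :: "complex \<Rightarrow> kgen \<Rightarrow> kgen \<Rightarrow> (kgen \<Rightarrow>\<^sub>0 complex poly poly)" where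
  "kbracket p (J i) (L j) = kbracket_skew p (J i) (L j)"
| "kbracket p (Gp i) (L j) = kbracket_skew p (Gp i) (L j)"
| "kbracket p (Gm i) (L j) = kbracket_skew p (Gm i) (L j)"
| "kbracket p (Gp i) (J j) = kbracket_skew p (Gp i) (J j)"
| "kbracket p (Gm i) (J j) = kbracket_skew p (Gm i) (J j)"
| "kbracket p (Gm i) (Gp j) = kbracket_skew p (Gm i) (Gp j)"
| "kbracket p a b = kbracket0 p a b"

type_synonym kelem = "kgen \<Rightarrow>\<^sub>0 complex poly"

definition KK :: "complex \<Rightarrow> (kelem, kelem) lam_module" where
  "KK p = free_lam_module kgen_parity (kbracket p)"

datatype vgen = v0 | v1

fun vgen_parity :: "vgen \<Rightarrow> bit" where
  "vgen_parity v0 = 0"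
| "vgen_parity v1 = 1"

type_synonym velem = "vgen \<Rightarrow>\<^sub>0 complex poly"

text \<open>\<open>s\<close> stands for the chosen square root of \<open>p\<close>.\<close>

fun v1_action ::
    "complex \<Rightarrow> complex \<Rightarrow> complex \<Rightarrow> complex \<Rightarrow> kgen \<Rightarrow> vgen \<Rightarrow> (vgen \<Rightarrow>\<^sub>0 complex poly poly)" where
  "v1_action p s \<Delta> \<alpha> (L 0) v0 = Poly_Mapping.single v0 (Cst p * (Del + Cst \<Delta> * Lam + Cst \<alpha>))"
| "v1_action p s \<Delta> \<alpha> (L 0) v1 =
     Poly_Mapping.single v1 (Cst p * (Del + Cst (\<Delta> + 1 / 2) * Lam + Cst \<alpha>))"
| "v1_action p s \<Delta> \<alpha> (J 0) v0 = Poly_Mapping.single v0 (Cst (- 2 * \<Delta>))"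
| "v1_action p s \<Delta> \<alpha> (J 0) v1 = Poly_Mapping.single v1 (Cst (1 - 2 * \<Delta>))"
| "v1_action p s \<Delta> \<alpha> (Gp 0) v0 = Poly_Mapping.single v1 (Cst s)"
| "v1_action p s \<Delta> \<alpha> (Gm 0) v1 =
     Poly_Mapping.single v0 (Cst (2 * s) * (Del + Cst (2 * \<Delta>) * Lam + Cst \<alpha>))"
| "v1_action p s \<Delta> \<alpha> _ _ = 0"

fun v2_action ::
    "complex \<Rightarrow> complex \<Rightarrow> complex \<Rightarrow> complex \<Rightarrow> kgen \<Rightarrow> vgen \<Rightarrow> (vgen \<Rightarrow>\<^sub>0 complex poly poly)" where
  "v2_action p s \<Delta> \<alpha> (L 0) v0 = Poly_Mapping.single v0 (Cst p * (Del + Cst \<Delta> * Lam + Cst \<alpha>))"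
| "v2_action p s \<Delta> \<alpha> (L 0) v1 =
     Poly_Mapping.single v1 (Cst p * (Del + Cst (\<Delta> + 1 / 2) * Lam + Cst \<alpha>))"
| "v2_action p s \<Delta> \<alpha> (J 0) v0 = Poly_Mapping.single v0 (Cst (2 * \<Delta>))"
| "v2_action p s \<Delta> \<alpha> (J 0) v1 = Poly_Mapping.single v1 (Cst (2 * \<Delta> - 1))"
| "v2_action p s \<Delta> \<alpha> (Gp 0) v1 =
     Poly_Mapping.single v0 (Cst (2 * s) * (Del + Cst (2 * \<Delta>) * Lam + Cst \<alpha>))"
| "v2_action p s \<Delta> \<alpha> (Gm 0) v0 = Poly_Mapping.single v1 (Cst s)"
| "v2_action p s \<Delta> \<alpha> _ _ = 0"

definition V1 :: "complex \<Rightarrow> complex \<Rightarrow> complex \<Rightarrow> complex \<Rightarrow> (kelem, velem) lam_module" where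
  "V1 p s \<Delta> \<alpha> = free_lam_module vgen_parity (v1_action p s \<Delta> \<alpha>)"

definition V2 :: "complex \<Rightarrow> complex \<Rightarrow> complex \<Rightarrow> complex \<Rightarrow> (kelem, velem) lam_module" where
  "V2 p s \<Delta> \<alpha> = free_lam_module vgen_parity (v2_action p s \<Delta> \<alpha>)"

text \<open>
  The subspace \<open>\<complex>[\<partial>](\<partial>+\<alpha>)v\<^sub>0 \<oplus> \<complex>[\<partial>](1/2 v\<^sub>1)\<close>; the sum is direct since the two summands lie in
  the spans of different basis vectors.
\<close>

definition sub_space :: "(kelem, velem) lam_module \<Rightarrow> complex \<Rightarrow> velem set" where
  "sub_space M \<alpha> =
     cyclic_span M (Poly_Mapping.single v0 [:\<alpha>, 1:]) <+>\<^bsub>M\<^esub>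
     cyclic_span M (Poly_Mapping.single v1 [:1 / 2:])"

end

theory Submission
  imports Defs
begin

text \<open>
  In a free module the action of \<open>a\<close> on \<open>v\<close>, evaluated at \<open>\<lambda> = l\<close>, is biadditive and satisfies
  \<open>(f(\<partial>)a)\<^sub>l(g(\<partial>)v) = f(-l) g(\<partial>+l) (a\<^sub>l v)\<close>; hence skew-symmetry, the Jacobi identity and the module
  axioms need only be verified on basis vectors.

  If a graded submodule contains \<open>f(\<partial>)v\<^sub>0\<close> with \<open>f \<noteq> 0\<close>, the coefficient of the top power of \<open>\<lambda>\<close> in the
  action of the operator \<open>G\<^sup>\<plusminus>\<close> that maps \<open>v\<^sub>0\<close> to \<open>v\<^sub>1\<close> shows that it contains \<open>v\<^sub>1\<close>.  In the same way
  \<open>g(\<partial>)v\<^sub>1\<close> with \<open>g \<noteq> 0\<close> yields \<open>v\<^sub>0\<close> if \<open>\<Delta> \<noteq> 0\<close>, and \<open>(\<partial>+\<alpha>)v\<^sub>0\<close> if \<open>\<Delta> = 0\<close>.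
  For \<open>\<Delta> = 0\<close> every coefficient of the action lies in the kernel of
  \<open>f(\<partial>)v\<^sub>0 + g(\<partial>)v\<^sub>1 \<mapsto> f(-\<alpha>)\<close>, which is therefore the only proper nonzero submodule, with
  trivial quotient.
\<close>

section \<open>Images, quotients and parity reversal of conformal modules\<close>

lemma carrier_cdel [simp]: "carrier cdel = UNIV"
  by (simp add: ring_of_type_algebra_def)

lemma set_add_eq: "A <+>\<^bsub>M\<^esub> B = {a \<oplus>\<^bsub>M\<^esub> b | a b. a \<in> A \<and> b \<in> B}"
  by (auto simp: set_add_def')

context super_module
begin

lemma part_subset: "part M i \<subseteq> carrier M"
  using part_submodule[of i] submodule.axioms(1) subgroup.subset by fastforce

lemma lam_eval_closed: "(\<And>n. f n \<in> carrier M) \<Longrightarrow> lam_eval M f s \<in> carrier M"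
  unfolding lam_eval_def by (rule finsum_closed) auto

end

text \<open>Most module axioms pass to the image of a map that respects all operations. The
  quotient, the trivial module and the submodule with its inherited structure all arise in this way.
  The exception is that the even and the odd part meet in zero: this can fail when the kernel is not
  graded, hence the assumption \<open>image_Int\<close>.\<close>

locale conformal_image = conformal_module R M
  for R :: "('r, 'r) lam_module" and M :: "('r, 'm) lam_module" +
  fixes M' :: "('r, 'n) lam_module" and \<phi> :: "'m \<Rightarrow> 'n"
  assumes image_carrier: "carrier M' = \<phi> ` carrier M"
    and image_zero: "zero M' = \<phi> \<zero>\<^bsub>M\<^esub>"
    and image_add: "\<lbrakk>v \<in> carrier M; w \<in> carrier M\<rbrakk> \<Longrightarrow> \<phi> (v \<oplus>\<^bsub>M\<^esub> w) = \<phi> v \<oplus>\<^bsub>M'\<^esub> \<phi> w"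
    and image_smult: "v \<in> carrier M \<Longrightarrow> \<phi> (f \<odot>\<^bsub>M\<^esub> v) = f \<odot>\<^bsub>M'\<^esub> \<phi> v"
    and image_part: "part M' i = \<phi> ` part M i"
    and image_act: "\<lbrakk>a \<in> carrier R; v \<in> carrier M\<rbrakk> \<Longrightarrow> \<phi> (act M a v n) = act M' a (\<phi> v) n"
    and image_Int: "part M' 0 \<inter> part M' 1 = {\<zero>\<^bsub>M'\<^esub>}"
begin

lemma image_abelian_group: "abelian_group M'"
proof (rule abelian_groupI)
  show "\<exists>y\<in>carrier M'. y \<oplus>\<^bsub>M'\<^esub> x = \<zero>\<^bsub>M'\<^esub>" if "x \<in> carrier M'" for x
  proof -
    from that obtain v where "v \<in> carrier M" "x = \<phi> v"
      by (auto simp: image_carrier)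
    then show ?thesis
      by (auto simp: image_carrier image_zero M.l_neg simp flip: image_add intro!: bexI[of _ "\<ominus>\<^bsub>M\<^esub> v"])
  qed
  show "x \<oplus>\<^bsub>M'\<^esub> y = y \<oplus>\<^bsub>M'\<^esub> x" if "x \<in> carrier M'" "y \<in> carrier M'" for x y
    using that M.a_comm by (force simp: image_carrier simp flip: image_add)
qed (auto simp: image_carrier image_zero M.a_assoc simp flip: image_add)

interpretation image: abelian_group M' by (rule image_abelian_group)

lemma image_a_inv: "v \<in> carrier M \<Longrightarrow> \<phi> (\<ominus>\<^bsub>M\<^esub> v) = \<ominus>\<^bsub>M'\<^esub> \<phi> v"
  by (rule image.minus_equality[symmetric]) (auto simp: image_carrier image_zero M.l_neg simp flip: image_add)

lemma image_minus: "\<lbrakk>v \<in> carrier M; w \<in> carrier M\<rbrakk> \<Longrightarrow> \<phi> (v \<ominus>\<^bsub>M\<^esub> w) = \<phi> v \<ominus>\<^bsub>M'\<^esub> \<phi> w"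
  by (simp add: a_minus_def image_add image_a_inv)

lemma image_set_add:
  assumes "A \<subseteq> carrier M" "B \<subseteq> carrier M"
  shows "\<phi> ` A <+>\<^bsub>M'\<^esub> \<phi> ` B = \<phi> ` (A <+>\<^bsub>M\<^esub> B)"
proof -
  have "\<phi> v \<oplus>\<^bsub>M'\<^esub> \<phi> w = \<phi> (v \<oplus>\<^bsub>M\<^esub> w)" if "v \<in> A" "w \<in> B" for v w
    using image_add[of v w] subsetD[OF assms(1) that(1)] subsetD[OF assms(2) that(2)] by simp
  then show ?thesis
    unfolding set_add_eq by (intro equalityI subsetI; clarsimp) (blast, metis imageI)
qed

lemma image_finsum:
  assumes "finite A" "f \<in> A \<rightarrow> carrier M"
  shows "\<phi> (finsum M f A) = finsum M' (\<lambda>n. \<phi> (f n)) A"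
  using assms by (induction A) (auto simp: image_zero image_carrier image_add Pi_iff)

lemma image_lam_eval:
  assumes "\<And>n. f n \<in> carrier M" "finite {n. f n \<noteq> \<zero>\<^bsub>M\<^esub>}"
  shows "\<phi> (lam_eval M f s) = lam_eval M' (\<lambda>n. \<phi> (f n)) s"
proof -
  have "\<phi> (lam_eval M f s) = (\<Oplus>\<^bsub>M'\<^esub>n\<in>{n. f n \<noteq> \<zero>\<^bsub>M\<^esub>}. s ^ n \<odot>\<^bsub>M'\<^esub> \<phi> (f n))"
    unfolding lam_eval_def using assms by (subst image_finsum) (auto simp: image_smult)
  \<comment> \<open>\<open>\<phi>\<close> may send a nonzero coefficient to zero, so the support can
    shrink; the terms dropped are zero.\<close>
  also have "\<dots> = (\<Oplus>\<^bsub>M'\<^esub>n\<in>{n. \<phi> (f n) \<noteq> \<zero>\<^bsub>M'\<^esub>}. s ^ n \<odot>\<^bsub>M'\<^esub> \<phi> (f n))"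
  proof (rule image.add.finprod_mono_neutral_cong_right)
    show "s ^ n \<odot>\<^bsub>M'\<^esub> \<phi> (f n) = \<zero>\<^bsub>M'\<^esub>"
      if "n \<in> {n. f n \<noteq> \<zero>\<^bsub>M\<^esub>} - {n. \<phi> (f n) \<noteq> \<zero>\<^bsub>M'\<^esub>}" for n
      using that assms by (simp add: image_zero flip: image_smult)
  qed (use assms in \<open>auto simp: image_zero image_carrier simp flip: image_smult\<close>)
  finally show ?thesis by (simp add: lam_eval_def)
qed

lemma image_lam_eval_act:
  assumes "a \<in> carrier R" "v \<in> carrier M"
  shows "lam_eval M' (act M' a (\<phi> v)) s = \<phi> (lam_eval M (act M a v) s)"
proof -
  have "act M' a (\<phi> v) = (\<lambda>n. \<phi> (act M a v n))"
    using assms by (simp add: image_act fun_eq_iff)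
  with assms show ?thesis
    by (simp add: image_lam_eval act_closed act_finite)
qed

lemma image_module: "module cdel M'"
proof (rule moduleI)
  show "cring cdel" by (rule cring_from_type_algebra)
qed (auto simp: image_carrier M.smult_l_distr M.smult_r_distr M.smult_assoc1 image_abelian_group
      simp flip: image_smult image_add)

lemma image_submodule:
  assumes "submodule N cdel M"
  shows "submodule (\<phi> ` N) cdel M'"
proof -
  interpret N: submodule N cdel M by fact
  have N: "N \<subseteq> carrier M" using N.subset by simp
  have inv: "\<ominus>\<^bsub>M\<^esub> v \<in> N" if "v \<in> N" for v
    using N.m_inv_closed[OF that] by (simp add: a_inv_def)
  show ?thesis
  proof (intro submodule.intro subgroup.intro submodule_axioms.intro)
    show "inv\<^bsub>add_monoid M'\<^esub> x \<in> \<phi> ` N" if "x \<in> \<phi> ` N" for x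
      using that N inv by (auto simp flip: a_inv_def image_a_inv)
    show "x \<otimes>\<^bsub>add_monoid M'\<^esub> y \<in> \<phi> ` N" if "x \<in> \<phi> ` N" "y \<in> \<phi> ` N" for x y
      using that N N.m_closed by (force simp: image_add[symmetric] subset_iff)
  qed (use N N.one_closed N.smult_closed in \<open>auto simp: image_carrier image_zero simp flip: image_smult\<close>)
qed

lemma image_super_module: "super_module M'"
proof (intro super_module.intro super_module_axioms.intro image_module image_Int)
  show "submodule (part M' i) cdel M'" for i
    unfolding image_part by (rule image_submodule, rule M.part_submodule)
  show "part M' 0 <+>\<^bsub>M'\<^esub> part M' 1 = carrier M'"
  proof -
    have "part M' 0 <+>\<^bsub>M'\<^esub> part M' 1 = \<phi> ` (part M 0 <+>\<^bsub>M\<^esub> part M 1)"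
      unfolding image_part by (rule image_set_add[OF M.part_subset M.part_subset])
    then show ?thesis by (simp add: M.part_sum image_carrier)
  qed
qed

lemma image_lambda_product: "lambda_product R M'"
proof (intro lambda_product.intro lambda_product_axioms.intro image_super_module R.R.super_module_axioms)
  show "finite {n. act M' a x n \<noteq> \<zero>\<^bsub>M'\<^esub>}" if "a \<in> carrier R" "x \<in> carrier M'" for a x
  proof -
    from that obtain v where v: "v \<in> carrier M" "x = \<phi> v" by (auto simp: image_carrier)
    show ?thesis
      by (rule finite_subset[OF _ act_finite[OF that(1) v(1)]]) (use that v in \<open>auto simp: image_zero simp flip: image_act\<close>)
  qed
  show "act M' a x n \<in> part M' (i + j)" if "a \<in> part R i" "x \<in> part M' j" for a x n i j
  proof -
    from that(2) obtain v where v: "v \<in> part M j" "x = \<phi> v" by (auto simp: image_part)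
    then show ?thesis
      using act_parity[OF that(1) v(1)] that(1) R.R.part_subset M.part_subset
      by (auto simp: image_part subset_iff simp flip: image_act)
  qed
qed (auto simp: image_carrier act_closed image_lam_eval_act act_add_left act_add_right act_scale_left
    act_scale_right act_del_left act_del_right M.lam_eval_closed simp flip: image_smult image_add image_act)

lemma image_conformal_module: "conformal_module R M'"
proof (intro conformal_module.intro conformal_module_axioms.intro image_lambda_product R.lie_conformal_superalgebra_axioms)
  show "lam_eval M' (act M' (lam_eval R (act R a b) [:l:]) x) [:l + m:] =
        lam_eval M' (act M' a (lam_eval M' (act M' b x) [:m:])) [:l:] \<ominus>\<^bsub>M'\<^esub>
          [:koszul i j:] \<odot>\<^bsub>M'\<^esub> lam_eval M' (act M' b (lam_eval M' (act M' a x) [:l:])) [:m:]"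
    if ab: "a \<in> part R i" "b \<in> part R j" and x: "x \<in> carrier M'" for a b i j x l m
  proof -
    from x obtain v where v: "v \<in> carrier M" "x = \<phi> v" by (auto simp: image_carrier)
    have ab': "a \<in> carrier R" "b \<in> carrier R"
      using ab R.R.part_subset by auto
    note closed = R.R.lam_eval_closed M.lam_eval_closed R.act_closed act_closed
    show ?thesis
      using act_bracket[OF ab v(1), of l m] v ab'
      by (simp add: image_lam_eval_act closed flip: image_smult image_minus)
  qed
qed

text \<open>The axioms of \<open>M'\<close> are already transported, so the inverse of
  \<open>\<phi>\<close> is a homomorphism. This direction, from the image back to \<open>M\<close>,
  puts the submodule or the quotient on the left.\<close>

lemma image_module_iso:
  assumes inj: "inj_on \<phi> (carrier M)"
  shows "module_iso R M' M"
proof -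
  let ?\<psi> = "inv_into (carrier M) \<phi>"
  have [simp]: "?\<psi> (\<phi> v) = v" if "v \<in> carrier M" for v
    using that inj by simp
  have "conformal_hom R M' M ?\<psi>"
  proof (intro conformal_hom.intro conformal_hom_axioms.intro image_conformal_module conformal_module_axioms)
  qed (use M.part_subset in \<open>auto simp: image_carrier image_part subset_iff act_closed
      simp flip: image_add image_smult image_act\<close>)
  moreover have "bij_betw ?\<psi> (carrier M') (carrier M)"
    unfolding image_carrier using inj by (intro bij_betw_inv_into inj_on_imp_bij_betw)
  ultimately show ?thesis unfolding module_iso_def by blast
qed

end


section \<open>Parity reversal\<close>

lemma parity_rev_simps [simp]:
  "carrier (parity_rev M) = carrier M" "zero (parity_rev M) = zero M" "add (parity_rev M) = add M"
  "module.smult (parity_rev M) = module.smult M" "part (parity_rev M) = (\<lambda>i. part M (i + 1))"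
  "act (parity_rev M) = act M" "add_monoid (parity_rev M) = add_monoid M"
  by (simp_all add: parity_rev_def)

text \<open>Indices live in \<open>bit\<close>, where \<open>i + 1 + 1 = i\<close>. Being an
  involution, reversal turns one-sided implications below into equivalences.\<close>

lemma parity_rev_parity_rev [simp]: "parity_rev (parity_rev M) = M"
proof -
  have "of_bool (i = 1) = i" for i :: bit by (cases i) simp_all
  then show ?thesis by (cases M) (simp add: parity_rev_def)
qed

lemma lam_eval_parity_rev [simp]: "lam_eval (parity_rev M) = lam_eval M"
  by (simp add: lam_eval_def finsum_def fun_eq_iff)

lemma a_minus_parity_rev [simp]: "x \<ominus>\<^bsub>parity_rev M\<^esub> y = x \<ominus>\<^bsub>M\<^esub> y"
  by (simp add: a_minus_def a_inv_def)

lemma set_add_parity_rev [simp]: "A <+>\<^bsub>parity_rev M\<^esub> B = A <+>\<^bsub>M\<^esub> B"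
  by (simp add: set_add_def)

lemma submodule_parity_rev [simp]: "submodule N K (parity_rev M) \<longleftrightarrow> submodule N K M"
  by (simp add: submodule_def submodule_axioms_def)

lemma module_parity_rev [simp]: "module K (parity_rev M) \<longleftrightarrow> module K M"
  by (simp add: module_def module_axioms_def abelian_group_def abelian_group_axioms_def abelian_monoid_def)

text \<open>Reversal exchanges the summands in the decompositions into even and odd part, so
  \<open>part_sum\<close> and \<open>graded\<close> carry over only up to the order of the
  sum.\<close>

lemma (in abelian_monoid) set_add_commute:
  assumes "A \<subseteq> carrier G" "B \<subseteq> carrier G"
  shows "A <+>\<^bsub>G\<^esub> B = B <+>\<^bsub>G\<^esub> A"
proof -
  have "x \<oplus> y = y \<oplus> x" if "x \<in> A" "y \<in> B" for x y
    using subsetD[OF assms(1) that(1)] subsetD[OF assms(2) that(2)] by (rule a_comm)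
  then show ?thesis unfolding set_add_eq by metis
qed

lemma super_module_parity_rev:
  assumes "super_module M"
  shows "super_module (parity_rev M)"
proof -
  interpret super_module M by fact
  show ?thesis
  proof (intro super_module.intro super_module_axioms.intro)
    show "part (parity_rev M) 0 <+>\<^bsub>parity_rev M\<^esub> part (parity_rev M) 1 = carrier (parity_rev M)"
      using set_add_commute[OF part_subset part_subset, of 1 0] part_sum by simp
  qed (use part_Int in \<open>auto simp: part_submodule module_axioms\<close>)
qed

lemma conformal_module_parity_rev:
  assumes "conformal_module R M"
  shows "conformal_module R (parity_rev M)"
proof -
  interpret conformal_module R M by fact
  show ?thesis
  proof (intro conformal_module.intro conformal_module_axioms.intro lambda_product.intro lambda_product_axioms.intro
      super_module_parity_rev R.lie_conformal_superalgebra_axioms R.R.super_module_axioms M.super_module_axioms)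
    show "act (parity_rev M) a v n \<in> part (parity_rev M) (i + j)"
      if "a \<in> part R i" "v \<in> part (parity_rev M) j" for a v n i j
      using act_parity[OF that(1), of v "j + 1"] that(2) by (simp add: add.assoc)
  qed (simp_all add: act_closed act_finite act_add_left act_add_right act_scale_left act_scale_right
      act_del_left act_del_right act_bracket)
qed

lemma conformal_submodule_parity_rev:
  assumes "conformal_submodule R M N"
  shows "conformal_submodule R (parity_rev M) N"
proof -
  interpret conformal_submodule R M N by fact
  have "N \<subseteq> carrier M" using subset by simp
  then have "(N \<inter> part M 1) <+>\<^bsub>M\<^esub> (N \<inter> part M 0) = N"
    using M.set_add_commute[of "N \<inter> part M 1" "N \<inter> part M 0"] graded by auto
  then show ?thesis
    by (intro conformal_submodule.intro conformal_submodule_axioms.intro conformal_module_parity_rev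
        conformal_module_axioms) (simp_all add: submodule_axioms act_invariant)
qed

lemma nontrivial_submodule_parity_rev [simp]:
  "nontrivial_submodule R (parity_rev M) N \<longleftrightarrow> nontrivial_submodule R M N"
  using conformal_submodule_parity_rev[of R M N] conformal_submodule_parity_rev[of R "parity_rev M" N]
  by (auto simp: nontrivial_submodule_def)

lemma simple_module_parity_rev [simp]: "simple_module R (parity_rev M) \<longleftrightarrow> simple_module R M"
  using conformal_module_parity_rev[of R M] conformal_module_parity_rev[of R "parity_rev M"]
  by (auto simp: simple_module_def)

lemma submod_parity_rev: "submod (parity_rev M) N = parity_rev (submod M N)"
  by (simp add: submod_def parity_rev_def)

lemma quotmod_parity_rev: "quotmod (parity_rev M) N = parity_rev (quotmod M N)"
  by (simp add: quotmod_def parity_rev_def A_RCOSETS_def a_r_coset_def set_add_def)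

lemma module_iso_parity_rev:
  assumes "module_iso R M M'"
  shows "module_iso R (parity_rev M) (parity_rev M')"
proof -
  from assms obtain \<phi> where hom: "conformal_hom R M M' \<phi>" and bij: "bij_betw \<phi> (carrier M) (carrier M')"
    unfolding module_iso_def by blast
  interpret conformal_hom R M M' \<phi> by fact
  have "conformal_hom R (parity_rev M) (parity_rev M') \<phi>"
    by (intro conformal_hom.intro conformal_hom_axioms.intro conformal_module_parity_rev
        M.conformal_module_axioms M'.conformal_module_axioms)
      (simp_all add: hom_closed hom_add hom_smult hom_parity hom_act)
  with bij show ?thesis unfolding module_iso_def by auto
qed

section \<open>The first isomorphism theorem\<close>

context conformal_image
begin

text \<open>The cosets of the kernel are the fibres of \<open>\<phi>\<close>, so the quotient is in
  turn an image of \<open>M'\<close>, under the map that sends a point to its fibre. The transport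
  supplies the module axioms of \<open>quotmod M N\<close>, and injectivity of the fibre map gives
  the isomorphism.\<close>

lemma quotient_module_iso:
  assumes N: "N = {v \<in> carrier M. \<phi> v = \<zero>\<^bsub>M'\<^esub>}"
  shows "module_iso R (quotmod M N) M'"
proof -
  interpret M': conformal_module R M' by (rule image_conformal_module)
  define \<chi> where "\<chi> y = {v \<in> carrier M. \<phi> v = y}" for y
  have coset: "N +>\<^bsub>M\<^esub> x = \<chi> (\<phi> x)" if x: "x \<in> carrier M" for x
  proof (intro equalityI subsetI)
    fix v assume "v \<in> N +>\<^bsub>M\<^esub> x"
    with x show "v \<in> \<chi> (\<phi> x)"
      by (auto simp: a_r_coset_def' N \<chi>_def image_add image_carrier)
  next
    fix v assume "v \<in> \<chi> (\<phi> x)"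
    with x have v: "v \<in> carrier M" "\<phi> v = \<phi> x"
      by (simp_all add: \<chi>_def)
    have "v = (v \<ominus>\<^bsub>M\<^esub> x) \<oplus>\<^bsub>M\<^esub> x"
      using x v by (simp add: a_minus_def M.a_assoc M.l_neg)
    moreover have "v \<ominus>\<^bsub>M\<^esub> x \<in> N"
      using x v by (simp add: N a_minus_def image_add image_a_inv image_carrier M'.M.r_neg)
    ultimately show "v \<in> N +>\<^bsub>M\<^esub> x"
      by (auto simp: a_r_coset_def')
  qed
  have nonempty: "\<chi> y \<noteq> {}" if "y \<in> carrier M'" for y
    using that by (auto simp: \<chi>_def image_carrier)
  \<comment> \<open>The operations of \<open>quotmod\<close> are unions over representatives. If
    \<open>h\<close> respects the fibres, all members of the union coincide, and since the fibre is
    nonempty the union is that common coset.\<close>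
  have UN_const: "(\<Union>x\<in>\<chi> (\<phi> v). N +>\<^bsub>M\<^esub> h x) = \<chi> (\<phi> (h v))"
    if "v \<in> carrier M" "\<And>x. x \<in> carrier M \<Longrightarrow> h x \<in> carrier M"
      "\<And>x y. \<lbrakk>x \<in> carrier M; y \<in> carrier M; \<phi> x = \<phi> y\<rbrakk> \<Longrightarrow> \<phi> (h x) = \<phi> (h y)" for v h
  proof -
    have "(\<Union>x\<in>\<chi> (\<phi> v). N +>\<^bsub>M\<^esub> h x) = (\<Union>x\<in>\<chi> (\<phi> v). \<chi> (\<phi> (h v)))"
    proof (rule SUP_cong[OF refl])
      fix x assume "x \<in> \<chi> (\<phi> v)"
      then have "x \<in> carrier M" "\<phi> x = \<phi> v" by (simp_all add: \<chi>_def)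
      with that(1) that(2)[of x] that(3)[of x v] show "N +>\<^bsub>M\<^esub> h x = \<chi> (\<phi> (h v))"
        by (simp add: coset)
    qed
    also have "\<dots> = \<chi> (\<phi> (h v))"
      using nonempty[of "\<phi> v"] that(1) by (auto simp: image_carrier)
    finally show ?thesis .
  qed
  have \<chi>_inj: "inj_on \<chi> (carrier M')"
  proof (rule inj_onI)
    fix y z assume "y \<in> carrier M'" "z \<in> carrier M'" "\<chi> y = \<chi> z"
    with nonempty[of y] show "y = z" unfolding \<chi>_def by blast
  qed
  have \<chi>_part: "part (quotmod M N) i = \<chi> ` part M' i" for i
    using M.part_subset[of i] by (auto simp: quotmod_def image_part coset subset_iff image_image intro!: image_cong)
  have \<chi>_zero: "\<chi> \<zero>\<^bsub>M'\<^esub> = N" by (simp add: N \<chi>_def)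
  interpret quot: conformal_image R M' "quotmod M N" \<chi>
  proof (intro conformal_image.intro conformal_image_axioms.intro image_conformal_module \<chi>_part)
    show "carrier (quotmod M N) = \<chi> ` carrier M'"
      by (auto simp: quotmod_def A_RCOSETS_def' image_carrier coset)
    show "\<zero>\<^bsub>quotmod M N\<^esub> = \<chi> \<zero>\<^bsub>M'\<^esub>"
      by (simp add: quotmod_def \<chi>_zero)
    show "\<chi> (v \<oplus>\<^bsub>M'\<^esub> w) = \<chi> v \<oplus>\<^bsub>quotmod M N\<^esub> \<chi> w" if vw: "v \<in> carrier M'" "w \<in> carrier M'" for v w
    proof -
      obtain v' w' where v': "v' \<in> carrier M" "v = \<phi> v'" and w': "w' \<in> carrier M" "w = \<phi> w'"
        using vw by (auto simp: image_carrier)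
      \<comment> \<open>To split a point over a sum, a representative \<open>w'\<close> over
        \<open>w\<close> is subtracted: the difference lies over \<open>v\<close>.\<close>
      have "x \<in> \<chi> v <+>\<^bsub>M\<^esub> \<chi> w" if "x \<in> carrier M" "\<phi> x = v \<oplus>\<^bsub>M'\<^esub> w" for x
      proof -
        have "x = (x \<ominus>\<^bsub>M\<^esub> w') \<oplus>\<^bsub>M\<^esub> w'"
          using that w' by (simp add: a_minus_def M.a_assoc M.l_neg)
        moreover have "\<phi> (x \<ominus>\<^bsub>M\<^esub> w') = v"
          using that v' w' vw by (simp add: image_minus) (simp add: a_minus_def M'.M.a_assoc M'.M.r_neg)
        ultimately show ?thesis
          using that w' unfolding set_add_eq \<chi>_def by blast
      qed
      then show ?thesis
        by (auto simp: quotmod_def \<chi>_def set_add_eq image_add)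
    qed
    show "\<chi> (f \<odot>\<^bsub>M'\<^esub> v) = f \<odot>\<^bsub>quotmod M N\<^esub> \<chi> v" if "v \<in> carrier M'" for f v
    proof -
      from that obtain x where x: "x \<in> carrier M" "v = \<phi> x" by (auto simp: image_carrier)
      with UN_const[of x "\<lambda>x. f \<odot>\<^bsub>M\<^esub> x"] show ?thesis
        by (simp add: quotmod_def image_smult)
    qed
    show "\<chi> (act M' a v n) = act (quotmod M N) a (\<chi> v) n" if "a \<in> carrier R" "v \<in> carrier M'" for a v n
    proof -
      from that(2) obtain x where x: "x \<in> carrier M" "v = \<phi> x" by (auto simp: image_carrier)
      with UN_const[of x "\<lambda>x. act M a x n"] that(1) show ?thesis
        by (simp add: quotmod_def image_act act_closed)
    qed
    show "part (quotmod M N) 0 \<inter> part (quotmod M N) 1 = {\<zero>\<^bsub>quotmod M N\<^esub>}"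
      using \<chi>_inj image_Int M'.M.part_subset
      by (simp add: \<chi>_part flip: inj_on_image_Int) (simp add: quotmod_def \<chi>_zero)
  qed
  show ?thesis by (rule quot.image_module_iso[OF \<chi>_inj])
qed

end

section \<open>Free modules with a sesquilinear action\<close>

definition smul :: "complex poly \<Rightarrow> ('b \<Rightarrow>\<^sub>0 complex poly) \<Rightarrow> ('b \<Rightarrow>\<^sub>0 complex poly)" where
  "smul f = Poly_Mapping.map (\<lambda>g. f * g)"

lemma lookup_map': "f 0 = 0 \<Longrightarrow> Poly_Mapping.lookup (Poly_Mapping.map f x) k = f (Poly_Mapping.lookup x k)"
  by (simp add: Poly_Mapping.map.rep_eq when_def)

lemma lookup_smul [simp]: "Poly_Mapping.lookup (smul f x) k = f * Poly_Mapping.lookup x k"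
  by (simp add: smul_def lookup_map')

lemma smul_single [simp]: "smul f (Poly_Mapping.single b g) = Poly_Mapping.single b (f * g)"
  by (simp add: smul_def)

lemma smul_add: "smul f (x + y) = smul f x + smul f y"
  by (rule poly_mapping_eqI) (simp add: lookup_add algebra_simps)

lemma smul_add_left: "smul (f + g) x = smul f x + smul g x"
  by (rule poly_mapping_eqI) (simp add: lookup_add algebra_simps)

lemma smul_smul [simp]: "smul f (smul g x) = smul (f * g) x"
  by (rule poly_mapping_eqI) (simp add: algebra_simps)

lemma smul_0 [simp]: "smul f 0 = 0"
  by (rule poly_mapping_eqI) simp

lemma smul_0_left [simp]: "smul 0 x = 0"
  by (rule poly_mapping_eqI) simp

lemma smul_1 [simp]: "smul 1 x = x"
  by (rule poly_mapping_eqI) simp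

lemma smul_diff: "smul f (x - y) = smul f x - smul f y"
  by (rule poly_mapping_eqI) (simp add: lookup_minus algebra_simps)

lemma smul_minus_left: "smul (- f) x = - smul f x"
  by (rule poly_mapping_eqI) simp

lemma keys_smul: "Poly_Mapping.keys (smul f x) \<subseteq> Poly_Mapping.keys x"
  by (auto simp: in_keys_iff)

text \<open>The predicate \<open>Q\<close> on the support makes the parity of the basis vectors
  available in the case of monomials.\<close>

lemma poly_mapping_additive_induct [consumes 1, case_names zero single add]:
  fixes x :: "'a \<Rightarrow>\<^sub>0 'b::comm_monoid_add"
  assumes "\<forall>b\<in>Poly_Mapping.keys x. Q b"
    and zero: "P 0"
    and single: "\<And>b f. Q b \<Longrightarrow> P (Poly_Mapping.single b f)"
    and add: "\<And>x y. P x \<Longrightarrow> P y \<Longrightarrow> P (x + y)"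
  shows "P x"
proof -
  have P_sum: "P (\<Sum>b\<in>B. Poly_Mapping.single b (Poly_Mapping.lookup x b))"
    if "finite B" "\<forall>b\<in>B. Q b" for B
    using that by (induction B) (simp_all add: zero single add)
  have "x = (\<Sum>b\<in>Poly_Mapping.keys x. Poly_Mapping.single b (Poly_Mapping.lookup x b))"
    by (rule poly_mapping_eqI)
      (auto simp: lookup_sum lookup_single when_def sum.delta' in_keys_iff)
  with P_sum[OF finite_keys assms(1)] show ?thesis by simp
qed

text \<open>A nonzero polynomial over an integral domain has finitely many roots, whereas there are
  infinitely many complex constants. Identities at complex values of \<lambda> thus become
  identities of polynomials.\<close>

lemma poly_poly_eqI:
  fixes q r :: "complex poly poly"
  assumes "\<And>l. poly q [:l:] = poly r [:l:]"
  shows "q = r"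
proof (rule ccontr)
  assume "q \<noteq> r"
  then have "finite {x. poly (q - r) x = 0}"
    by (intro poly_roots_finite) simp
  moreover have "range (\<lambda>l::complex. [:l:]) \<subseteq> {x. poly (q - r) x = 0}"
    using assms by auto
  moreover have "infinite (range (\<lambda>l::complex. [:l:]))"
    by (subst finite_image_iff) (auto simp: inj_on_def infinite_UNIV_char_0)
  ultimately show False
    using finite_subset by blast
qed

lemma subst_del_0 [simp]: "subst_del 0 q = 0"
  by (simp add: subst_del_def)

lemma subst_del_pCons [simp]: "subst_del (pCons c f) q = Cst c + q * subst_del f q"
  by (simp add: subst_del_def map_poly_pCons)

lemma subst_del_pcompose: "subst_del f q = pcompose (map_poly (\<lambda>c. [:c:]) f) q"
  by (induction f) (simp_all add: map_poly_pCons pcompose_pCons)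

lemma poly_subst_del [simp]: "poly (subst_del f q) s = pcompose f (poly q s)"
  by (induction f) (simp_all add: pcompose_pCons)

lemma subst_del_1 [simp]: "subst_del 1 q = 1"
  by (simp add: one_pCons)

lemma subst_del_add: "subst_del (f + g) q = subst_del f q + subst_del g q"
  by (rule poly_poly_eqI) (simp add: pcompose_add)

text \<open>This is composition with a polynomial that is monic of degree one in \<lambda>. The
  leading coefficient is therefore free of \<partial>, which lets constants be isolated from
  arbitrary polynomial coefficients in the analysis of submodules.\<close>

lemma subst_del_Del_Lam:
  assumes "f \<noteq> 0"
  shows "degree (subst_del f (Del + Lam)) = degree f"
    and "lead_coeff (subst_del f (Del + Lam)) = [:lead_coeff f:]"
proof -
  have "degree (map_poly (\<lambda>c. [:c:]) f) = degree f"
    by (simp add: degree_map_poly)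
  then show "degree (subst_del f (Del + Lam)) = degree f"
    and "lead_coeff (subst_del f (Del + Lam)) = [:lead_coeff f:]"
    using lead_coeff_comp[of "Del + Lam" "map_poly (\<lambda>c. [:c:]) f"]
    by (simp_all add: subst_del_pcompose coeff_map_poly degree_pcompose)
qed

lemma subst_del_smult: "subst_del (smult c f) q = smult [:c:] (subst_del f q)"
  by (rule poly_poly_eqI) (simp add: pcompose_smult)

section \<open>Coefficients and values of the action on a free module\<close>

definition basis_act ::
    "('a \<Rightarrow> 'b \<Rightarrow> ('b \<Rightarrow>\<^sub>0 complex poly poly)) \<Rightarrow> 'a \<Rightarrow> 'b \<Rightarrow> complex poly \<Rightarrow> ('b \<Rightarrow>\<^sub>0 complex poly)" where
  "basis_act S a b s = Poly_Mapping.map (\<lambda>q. poly q s) (S a b)"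

definition free_act ::
    "('a \<Rightarrow> 'b \<Rightarrow> ('b \<Rightarrow>\<^sub>0 complex poly poly)) \<Rightarrow> ('a \<Rightarrow>\<^sub>0 complex poly) \<Rightarrow> ('b \<Rightarrow>\<^sub>0 complex poly) \<Rightarrow>
      nat \<Rightarrow> ('b \<Rightarrow>\<^sub>0 complex poly)" where
  "free_act S x v n = (\<Sum>a\<in>Poly_Mapping.keys x. \<Sum>b\<in>Poly_Mapping.keys v.
       Poly_Mapping.map
         (\<lambda>q. Polynomial.coeff
                (subst_del (Poly_Mapping.lookup x a) (- Lam) *
                 subst_del (Poly_Mapping.lookup v b) (Del + Lam) * q) n)
         (S a b))"

text \<open>The value of the action at \<lambda> = \<open>s\<close> in closed form, without passing
  through coefficients; \<open>lam_eval_free_act\<close> identifies it with \<open>lam_eval\<close>.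
  The argument \<open>s\<close> may contain \<partial>, because skew-symmetry substitutes
  \<open>- \<lambda> - \<partial>\<close>.\<close>

definition free_eval ::
    "('a \<Rightarrow> 'b \<Rightarrow> ('b \<Rightarrow>\<^sub>0 complex poly poly)) \<Rightarrow> ('a \<Rightarrow>\<^sub>0 complex poly) \<Rightarrow> ('b \<Rightarrow>\<^sub>0 complex poly) \<Rightarrow>
      complex poly \<Rightarrow> ('b \<Rightarrow>\<^sub>0 complex poly)" where
  "free_eval S x v s = (\<Sum>a\<in>Poly_Mapping.keys x. \<Sum>b\<in>Poly_Mapping.keys v.
     smul (pcompose (Poly_Mapping.lookup x a) (- s) *
           pcompose (Poly_Mapping.lookup v b) ([:0, 1:] + s)) (basis_act S a b s))"

lemma free_lam_module_simps [simp]: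
  "carrier (free_lam_module par S) = UNIV"
  "zero (free_lam_module par S) = 0"
  "add (free_lam_module par S) = (+)"
  "module.smult (free_lam_module par S) = smul"
  "part (free_lam_module par S) = (\<lambda>i. {x. \<forall>b\<in>Poly_Mapping.keys x. par b = i})"
  "act (free_lam_module par S) = free_act S"
  by (simp_all add: free_lam_module_def free_act_def smul_def fun_eq_iff)

lemma free_act_single: "free_act S (Poly_Mapping.single a f) (Poly_Mapping.single b g) n =
    Poly_Mapping.map (\<lambda>q. Polynomial.coeff (subst_del f (- Lam) * subst_del g (Del + Lam) * q) n) (S a b)"
  by (cases "f = 0"; cases "g = 0")
    (simp_all add: free_act_def, (rule sym, rule poly_mapping_eqI, simp add: lookup_map')+)

lemma free_act_add_left: "free_act S (x + y) v n = free_act S x v n + free_act S y v n"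
  unfolding free_act_def
  by (subst setsum_keys_plus_distrib)
    (simp_all add: subst_del_add sum.distrib[symmetric] algebra_simps poly_mapping_eq_iff fun_eq_iff
      lookup_sum lookup_add lookup_map')

lemma free_act_add_right: "free_act S x (v + w) n = free_act S x v n + free_act S x w n"
  unfolding free_act_def
  by (subst setsum_keys_plus_distrib)
    (simp_all add: subst_del_add sum.distrib[symmetric] algebra_simps poly_mapping_eq_iff fun_eq_iff
      lookup_sum lookup_add lookup_map')

lemma free_act_0 [simp]: "free_act S x 0 n = 0"
  by (simp add: free_act_def)

lemma free_eval_single: "free_eval S (Poly_Mapping.single a f) (Poly_Mapping.single b g) s =
    smul (pcompose f (- s) * pcompose g ([:0, 1:] + s)) (basis_act S a b s)"
  by (cases "f = 0"; cases "g = 0") (simp_all add: free_eval_def)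

lemma free_eval_add_left: "free_eval S (x + y) v s = free_eval S x v s + free_eval S y v s"
  unfolding free_eval_def
  by (subst setsum_keys_plus_distrib)
    (simp_all add: pcompose_add smul_add_left[symmetric] sum.distrib[symmetric] algebra_simps)

lemma free_eval_add_right: "free_eval S x (v + w) s = free_eval S x v s + free_eval S x w s"
  unfolding free_eval_def
  by (subst setsum_keys_plus_distrib)
    (simp_all add: pcompose_add smul_add_left[symmetric] sum.distrib[symmetric] algebra_simps)

lemma free_eval_0 [simp]: "free_eval S 0 v s = 0" "free_eval S x 0 s = 0"
  by (simp_all add: free_eval_def)

text \<open>Biadditive maps are determined by pairs of monomials. The predicates restrict these to
  fixed parities, since skew-symmetry involves a sign that depends on the parities.\<close>

lemma biadditive_eqI:
  fixes x :: "'a \<Rightarrow>\<^sub>0 'd::comm_monoid_add" and v :: "'b \<Rightarrow>\<^sub>0 'e::comm_monoid_add"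
  assumes "\<forall>a\<in>Poly_Mapping.keys x. P a" "\<forall>b\<in>Poly_Mapping.keys v. Q b"
    and "\<And>x y v. F (x + y) v = (F x v + F y v :: 'c::ab_group_add)" "\<And>x v w. F x (v + w) = F x v + F x w"
    and "\<And>x y v. G (x + y) v = G x v + G y v" "\<And>x v w. G x (v + w) = G x v + G x w"
    and eq: "\<And>a b f g. P a \<Longrightarrow> Q b \<Longrightarrow>
      F (Poly_Mapping.single a f) (Poly_Mapping.single b g) = G (Poly_Mapping.single a f) (Poly_Mapping.single b g)"
  shows "F x v = G x v"
proof -
  have [simp]: "F 0 v = 0" "F x 0 = 0" "G 0 v = 0" "G x 0 = 0" for x v
    using assms(3)[of 0 0 v] assms(4)[of x 0 0] assms(5)[of 0 0 v] assms(6)[of x 0 0] by simp_all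
  show ?thesis
    using assms(1)
  proof (induction x rule: poly_mapping_additive_induct)
    case (single a f)
    show ?case
      using assms(2) by (induction v rule: poly_mapping_additive_induct) (simp_all add: assms single)
  qed (simp_all add: assms)
qed

lemma free_eval_smul_left: "free_eval S (smul f x) v s = smul (pcompose f (- s)) (free_eval S x v s)"
  by (rule biadditive_eqI[where P = "\<lambda>_. True" and Q = "\<lambda>_. True" and x = x and v = v])
    (simp_all add: free_eval_add_left free_eval_add_right smul_add free_eval_single pcompose_mult algebra_simps)

lemma free_eval_smul_right: "free_eval S x (smul g v) s = smul (pcompose g ([:0, 1:] + s)) (free_eval S x v s)"
  by (rule biadditive_eqI[where P = "\<lambda>_. True" and Q = "\<lambda>_. True" and x = x and v = v])
    (simp_all add: free_eval_add_left free_eval_add_right smul_add free_eval_single pcompose_mult algebra_simps)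

text \<open>Coordinate \<open>c\<close> of the action as a polynomial in \<lambda>. Its coefficients
  are coordinates of \<open>free_act\<close> and its values are coordinates of
  \<open>free_eval\<close>, which links the two.\<close>

definition free_gf ::
    "('a \<Rightarrow> 'b \<Rightarrow> ('b \<Rightarrow>\<^sub>0 complex poly poly)) \<Rightarrow> ('a \<Rightarrow>\<^sub>0 complex poly) \<Rightarrow> ('b \<Rightarrow>\<^sub>0 complex poly) \<Rightarrow>
      'b \<Rightarrow> complex poly poly" where
  "free_gf S x v c = (\<Sum>a\<in>Poly_Mapping.keys x. \<Sum>b\<in>Poly_Mapping.keys v.
     subst_del (Poly_Mapping.lookup x a) (- Lam) * subst_del (Poly_Mapping.lookup v b) (Del + Lam) *
     Poly_Mapping.lookup (S a b) c)"

lemma lookup_free_act: "Poly_Mapping.lookup (free_act S x v n) c = Polynomial.coeff (free_gf S x v c) n"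
  by (simp add: free_act_def free_gf_def lookup_sum lookup_map' coeff_sum)

lemma lookup_free_eval: "Poly_Mapping.lookup (free_eval S x v s) c = poly (free_gf S x v c) s"
  by (simp add: free_eval_def free_gf_def lookup_sum lookup_map' poly_sum basis_act_def)

text \<open>A nonzero coefficient has a nonzero coordinate in the support of some
  \<open>S a b\<close>. There are finitely many such coordinates, and for each of them a degree
  bounds \<open>n\<close>.\<close>

lemma finite_free_act: "finite {n. free_act S x v n \<noteq> 0}"
proof (rule finite_subset)
  show "{n. free_act S x v n \<noteq> 0} \<subseteq>
    (\<Union>c\<in>(\<Union>a\<in>Poly_Mapping.keys x. \<Union>b\<in>Poly_Mapping.keys v. Poly_Mapping.keys (S a b)).
      {..Polynomial.degree (free_gf S x v c)})" (is "_ \<subseteq> (\<Union>c\<in>?C. _)")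
  proof
    fix n assume "n \<in> {n. free_act S x v n \<noteq> 0}"
    then obtain c where "Polynomial.coeff (free_gf S x v c) n \<noteq> 0"
      by (auto simp: poly_mapping_eq_iff fun_eq_iff lookup_free_act)
    then have "free_gf S x v c \<noteq> 0" "n \<le> Polynomial.degree (free_gf S x v c)"
      by (auto intro: le_degree)
    moreover from this(1) have "c \<in> ?C"
      unfolding free_gf_def by (force elim!: sum.not_neutral_contains_not_neutral simp: in_keys_iff)
    ultimately show "n \<in> (\<Union>c\<in>?C. {..Polynomial.degree (free_gf S x v c)})"
      by blast
  qed
qed simp

section \<open>Evaluation and lambda products on free modules\<close>

lemma finsum_eq_sum:
  assumes "abelian_monoid M" "carrier M = UNIV" "zero M = 0" "add M = (+)" "finite A"
  shows "finsum M f A = sum f A"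
proof -
  interpret abelian_monoid M by fact
  show ?thesis
    using assms(5) by (induction A) (simp_all add: assms(2-4) finsum_insert)
qed

lemma free_abelian_group: "abelian_group (free_lam_module par S)"
proof (rule abelian_groupI)
  show "\<exists>y\<in>carrier (free_lam_module par S). y \<oplus>\<^bsub>free_lam_module par S\<^esub> x = \<zero>\<^bsub>free_lam_module par S\<^esub>"
    for x by (auto intro!: exI[of _ "- x"])
qed (simp_all add: algebra_simps)

lemma free_a_inv: "\<ominus>\<^bsub>free_lam_module par S\<^esub> x = - x"
proof -
  interpret abelian_group "free_lam_module par S" by (rule free_abelian_group)
  show ?thesis by (rule minus_equality) simp_all
qed

lemma lam_eval_free:
  "finite {n. f n \<noteq> 0} \<Longrightarrow> lam_eval (free_lam_module par S) f s = (\<Sum>n\<in>{n. f n \<noteq> 0}. smul (s ^ n) (f n))"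
  using abelian_group.axioms(1)[OF free_abelian_group, of par S]
  by (simp add: lam_eval_def finsum_eq_sum)

lemma lookup_lam_eval_free:
  assumes fin: "finite {n. f n \<noteq> 0}" and f: "\<And>n. Poly_Mapping.lookup (f n) c = Polynomial.coeff q n"
  shows "Poly_Mapping.lookup (lam_eval (free_lam_module par S) f s) c = poly q s"
proof -
  have "Poly_Mapping.lookup (lam_eval (free_lam_module par S) f s) c =
      (\<Sum>n\<in>{n. f n \<noteq> 0}. Polynomial.coeff q n * s ^ n)"
    by (simp add: lam_eval_free[OF fin] lookup_sum f mult.commute)
  \<comment> \<open>The support of \<open>f\<close> and the range up to \<open>degree q\<close> need
    not be comparable: other coordinates may be nonzero beyond that degree, and \<open>f\<close> may
    vanish below it. Their union serves as an intermediate index set.\<close>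
  also have "\<dots> = (\<Sum>n\<in>{n. f n \<noteq> 0} \<union> {..Polynomial.degree q}. Polynomial.coeff q n * s ^ n)"
  proof (rule sum.mono_neutral_left)
    show "\<forall>n\<in>{n. f n \<noteq> 0} \<union> {..Polynomial.degree q} - {n. f n \<noteq> 0}. Polynomial.coeff q n * s ^ n = 0"
      using f by (auto simp flip: f)
  qed (use fin in auto)
  also have "\<dots> = (\<Sum>n\<le>Polynomial.degree q. Polynomial.coeff q n * s ^ n)"
    by (rule sum.mono_neutral_right) (use fin in \<open>auto simp: coeff_eq_0\<close>)
  finally show ?thesis by (simp add: poly_altdef)
qed

lemma lam_eval_free_act [simp]: "lam_eval (free_lam_module par S) (free_act S' x v) s = free_eval S' x v s"
  by (rule poly_mapping_eqI)
    (simp add: lookup_lam_eval_free[OF finite_free_act lookup_free_act] lookup_free_eval)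

text \<open>Each coordinate of a finitely supported sequence is a polynomial in \<lambda>,
  determined by its values at complex numbers. This is the way back from pointwise identities to
  coefficients.\<close>

lemma lam_eval_free_inj:
  assumes "finite {n. f n \<noteq> 0}" "finite {n. g n \<noteq> 0}"
    and "\<And>l. lam_eval (free_lam_module par S) f [:l:] = lam_eval (free_lam_module par S) g [:l:]"
  shows "f = g"
proof
  fix n
  show "f n = g n"
  proof (rule poly_mapping_eqI)
    fix c
    have fin: "finite {n. Poly_Mapping.lookup (h n) c \<noteq> 0}" if "finite {n. h n \<noteq> 0}"
      for h :: "nat \<Rightarrow> 'a \<Rightarrow>\<^sub>0 complex poly"
      using that by (rule rev_finite_subset) auto
    define q where "q h = Abs_poly (\<lambda>n. Poly_Mapping.lookup (h n) c)" for h :: "nat \<Rightarrow> 'a \<Rightarrow>\<^sub>0 complex poly"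
    have q: "Poly_Mapping.lookup (h n) c = Polynomial.coeff (q h) n" if "finite {n. h n \<noteq> 0}" for h n
      unfolding q_def using fin[OF that] by (subst Abs_poly_inverse) (auto simp: MOST_iff_cofinite)
    have "q f = q g"
      by (rule poly_poly_eqI)
        (metis assms lookup_lam_eval_free[OF assms(1) q[OF assms(1)]]
          lookup_lam_eval_free[OF assms(2) q[OF assms(2)]])
    then show "Poly_Mapping.lookup (f n) c = Poly_Mapping.lookup (g n) c"
      by (simp add: q assms)
  qed
qed

lemma free_module: "module cdel (free_lam_module par S)"
proof (rule moduleI)
  show "cring cdel" by (rule cring_from_type_algebra)
qed (simp_all add: free_abelian_group ring_of_type_algebra_def smul_add smul_add_left)

lemma split_parity:
  fixes par :: "'b \<Rightarrow> bit" and x :: "'b \<Rightarrow>\<^sub>0 'c::comm_monoid_add"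
  obtains y z where "x = y + z" "\<forall>b\<in>Poly_Mapping.keys y. par b = 0" "\<forall>b\<in>Poly_Mapping.keys z. par b = 1"
proof
  let ?p = "\<lambda>i. Poly_Mapping.mapp (\<lambda>b c. if par b = i then c else 0) x"
  show "x = ?p 0 + ?p 1"
    by (rule poly_mapping_eqI) (auto simp: lookup_add lookup_mapp when_def in_keys_iff)
qed (auto simp: in_keys_iff lookup_mapp when_def split: if_splits)

lemma free_super_module: "super_module (free_lam_module par S)"
proof (intro super_module.intro super_module_axioms.intro)
  fix i
  show "submodule (part (free_lam_module par S) i) cdel (free_lam_module par S)"
  proof (intro submodule.intro subgroup.intro submodule_axioms.intro)
    fix x assume "x \<in> part (free_lam_module par S) i"
    moreover have "inv\<^bsub>add_monoid (free_lam_module par S)\<^esub> x = - x"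
      using free_a_inv[of par S x] by (simp add: a_inv_def)
    ultimately show "inv\<^bsub>add_monoid (free_lam_module par S)\<^esub> x \<in> part (free_lam_module par S) i"
      by (auto simp: in_keys_iff)
  qed (use keys_add keys_smul in \<open>fastforce+\<close>)
next
  show "part (free_lam_module par S) 0 <+>\<^bsub>free_lam_module par S\<^esub> part (free_lam_module par S) 1 =
      carrier (free_lam_module par S)"
    by (auto simp: set_add_eq) (metis split_parity[of _ par])
  show "part (free_lam_module par S) 0 \<inter> part (free_lam_module par S) 1 = {\<zero>\<^bsub>free_lam_module par S\<^esub>}"
    by (auto simp flip: keys_eq_empty)
qed (rule free_module)

lemma free_act_scale_left: "free_act S (smul [:c:] x) v n = smul [:c:] (free_act S x v n)"
proof (rule biadditive_eqI[where P = "\<lambda>_. True" and Q = "\<lambda>_. True" and x = x and v = v and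
      G = "\<lambda>x v. smul [:c:] (free_act S x v n)"])
  fix a b f g
  show "free_act S (smul [:c:] (Poly_Mapping.single a f)) (Poly_Mapping.single b g) n =
    smul [:c:] (free_act S (Poly_Mapping.single a f) (Poly_Mapping.single b g) n)"
    by (rule poly_mapping_eqI) (simp add: free_act_single lookup_map' subst_del_smult)
qed (simp_all add: free_act_add_left free_act_add_right smul_add)

lemma free_act_scale_right: "free_act S x (smul [:c:] v) n = smul [:c:] (free_act S x v n)"
proof (rule biadditive_eqI[where P = "\<lambda>_. True" and Q = "\<lambda>_. True" and x = x and v = v and
      G = "\<lambda>x v. smul [:c:] (free_act S x v n)"])
  fix a b f g
  show "free_act S (Poly_Mapping.single a f) (smul [:c:] (Poly_Mapping.single b g)) n =
    smul [:c:] (free_act S (Poly_Mapping.single a f) (Poly_Mapping.single b g) n)"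
    by (rule poly_mapping_eqI) (simp add: free_act_single lookup_map' subst_del_smult)
qed (simp_all add: free_act_add_left free_act_add_right smul_add)

text \<open>Sesquilinearity is built into \<open>free_act\<close>, so the only condition on the
  table \<open>S\<close> is that it respects parity.\<close>

lemma free_lambda_product:
  assumes par: "\<And>a b c. c \<in> Poly_Mapping.keys (S a b) \<Longrightarrow> par c = parR a + par b"
  shows "lambda_product (free_lam_module parR SR) (free_lam_module par S)"
proof (intro lambda_product.intro lambda_product_axioms.intro free_super_module)
  fix x v i j n
  assume "x \<in> part (free_lam_module parR SR) i" "v \<in> part (free_lam_module par S) j"
  then have x: "\<forall>a\<in>Poly_Mapping.keys x. parR a = i" and v: "\<forall>b\<in>Poly_Mapping.keys v. par b = j"
    by simp_all
  have "par c = i + j" if "c \<in> Poly_Mapping.keys (free_act S x v n)" for c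
  proof -
    from that have "free_gf S x v c \<noteq> 0"
      by (auto simp: in_keys_iff lookup_free_act)
    then obtain a b where "a \<in> Poly_Mapping.keys x" "b \<in> Poly_Mapping.keys v" "c \<in> Poly_Mapping.keys (S a b)"
      unfolding free_gf_def by (force elim!: sum.not_neutral_contains_not_neutral simp: in_keys_iff)
    with x v par[of c a b] show ?thesis by simp
  qed
  then show "act (free_lam_module par S) x v n \<in> part (free_lam_module par S) (i + j)"
    by simp
qed (simp_all add: finite_free_act free_act_add_left free_act_add_right free_act_scale_left free_act_scale_right
      free_eval_smul_left free_eval_smul_right pcompose_pCons)

text \<open>All three terms are additive in \<open>x\<close>, \<open>y\<close> and \<open>v\<close>,
  and polynomial coefficients of the basis vectors contribute the same factor to each term. With
  \<open>SR = S\<close> this is the Jacobi identity; in general it is the module axiom.\<close>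

lemma free_bracket_identity:
  assumes basis: "\<And>a b c l m.
      free_eval S (basis_act SR a b [:l:]) (Poly_Mapping.single c 1) [:l + m:] =
        free_eval S (Poly_Mapping.single a 1) (basis_act S b c [:m:]) [:l:] -
        smul [:koszul (parR a) (parR b):] (free_eval S (Poly_Mapping.single b 1) (basis_act S a c [:l:]) [:m:])"
    and x: "\<forall>a\<in>Poly_Mapping.keys x. parR a = i" and y: "\<forall>b\<in>Poly_Mapping.keys y. parR b = j"
  shows "free_eval S (free_eval SR x y [:l:]) v [:l + m:] =
    free_eval S x (free_eval S y v [:m:]) [:l:] -
    smul [:koszul i j:] (free_eval S y (free_eval S x v [:l:]) [:m:])"
  using x
proof (induction x rule: poly_mapping_additive_induct)
  case (single a f)
  show ?case
    using y
  proof (induction y rule: poly_mapping_additive_induct)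
    case (single b g)
    have "\<forall>c\<in>Poly_Mapping.keys v. True" by simp
    then show ?case
    proof (induction v rule: poly_mapping_additive_induct)
      case (single c h)
      \<comment> \<open>The common factor \<open>f(-l) g(-m) h(\<partial>+l+m)\<close>. In the term
        with the inner bracket, \<open>g(\<partial>+l)\<close> becomes \<open>g(-m)\<close>, because
        \<partial> in the left argument turns into \<open>-(l+m)\<close>.\<close>
      define C where "C = pcompose f [:- l:] * pcompose g [:- m:] * pcompose h [:l + m, 1:]"
      have a: "Poly_Mapping.single a f = smul f (Poly_Mapping.single a 1)"
        and b: "Poly_Mapping.single b g = smul g (Poly_Mapping.single b 1)"
        and c: "Poly_Mapping.single c h = smul h (Poly_Mapping.single c 1)"
        by simp_all
      have const: "pcompose (pcompose q [:k:]) r = pcompose q [:k:]" for q r :: "complex poly" and k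
        by (simp add: pcompose_pCons flip: pcompose_assoc)
      have shift: "pcompose (pcompose q [:k, 1:]) r = pcompose q ([:k:] + r)" for q r :: "complex poly" and k
        by (simp add: pcompose_pCons flip: pcompose_assoc)
      have "free_eval S (free_eval SR (Poly_Mapping.single a f) (Poly_Mapping.single b g) [:l:])
          (Poly_Mapping.single c h) [:l + m:] =
        smul C (free_eval S (basis_act SR a b [:l:]) (Poly_Mapping.single c 1) [:l + m:])"
        by (subst c, subst free_eval_smul_right, subst free_eval_single, subst free_eval_smul_left)
          (simp add: pcompose_mult const shift C_def mult_ac)
      moreover have "free_eval S (Poly_Mapping.single a f)
          (free_eval S (Poly_Mapping.single b g) (Poly_Mapping.single c h) [:m:]) [:l:] =
        smul C (free_eval S (Poly_Mapping.single a 1) (basis_act S b c [:m:]) [:l:])"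
        by (subst a, subst free_eval_smul_left, subst free_eval_single, subst free_eval_smul_right)
          (simp add: pcompose_mult const shift C_def mult_ac add_ac)
      moreover have "free_eval S (Poly_Mapping.single b g)
          (free_eval S (Poly_Mapping.single a f) (Poly_Mapping.single c h) [:l:]) [:m:] =
        smul C (free_eval S (Poly_Mapping.single b 1) (basis_act S a c [:l:]) [:m:])"
        by (subst b, subst free_eval_smul_left, subst free_eval_single, subst free_eval_smul_right)
          (simp add: pcompose_mult const shift C_def mult_ac add_ac)
      ultimately show ?case
        by (simp only: basis smul_diff smul_smul mult.commute[of C] \<open>parR a = i\<close> \<open>parR b = j\<close>)
    qed (simp_all only: free_eval_0 smul_0 free_eval_add_right smul_add diff_0_right add_diff_add)
  qed (simp_all only: free_eval_0 smul_0 free_eval_add_left free_eval_add_right smul_add diff_0_right add_diff_add)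
qed (simp_all only: free_eval_0 smul_0 free_eval_add_left free_eval_add_right smul_add diff_0_right add_diff_add)

lemma free_lie_conformal_superalgebra:
  assumes par: "\<And>a b c. c \<in> Poly_Mapping.keys (S a b) \<Longrightarrow> par c = par a + par b"
    and skew: "\<And>a b l. basis_act S a b [:l:] = smul [:- koszul (par a) (par b):] (basis_act S b a (- [:l:] - [:0, 1:]))"
    and basis: "\<And>a b c l m.
      free_eval S (basis_act S a b [:l:]) (Poly_Mapping.single c 1) [:l + m:] =
        free_eval S (Poly_Mapping.single a 1) (basis_act S b c [:m:]) [:l:] -
        smul [:koszul (par a) (par b):] (free_eval S (Poly_Mapping.single b 1) (basis_act S a c [:l:]) [:m:])"
  shows "lie_conformal_superalgebra (free_lam_module par S)"
proof (intro lie_conformal_superalgebra.intro lie_conformal_superalgebra_axioms.intro free_lambda_product par)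
  fix x y i j and l :: complex
  \<comment> \<open>The substitution \<open>s = - \<lambda> - \<partial>\<close> exchanges the two
    sesquilinear factors: \<open>\<partial> + s\<close> becomes \<open>- \<lambda>\<close>, and
    \<open>- s\<close> becomes \<open>\<partial> + \<lambda>\<close>. Skew-symmetry on basis vectors
    therefore extends to arbitrary coefficients.\<close>
  have arg: "[:0, 1:] + (- [:l:] - [:0, 1:]) = - [:l:]" "- (- [:l:] - [:0, 1:]) = [:0, 1:] + [:l:]"
    by simp_all
  have skew_single: "free_eval S (Poly_Mapping.single a f) (Poly_Mapping.single b g) [:l:] =
      smul [:- koszul (par a) (par b):]
        (free_eval S (Poly_Mapping.single b g) (Poly_Mapping.single a f) (- [:l:] - [:0, 1:]))" for a b f g
    by (simp only: free_eval_single arg skew[of a b l] smul_smul mult_ac)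
  assume "x \<in> part (free_lam_module par S) i" "y \<in> part (free_lam_module par S) j"
  then have "\<forall>a\<in>Poly_Mapping.keys x. par a = i" "\<forall>b\<in>Poly_Mapping.keys y. par b = j"
    by simp_all
  then have "free_eval S x y [:l:] = smul [:- koszul i j:] (free_eval S y x (- [:l:] - [:0, 1:]))"
    by (rule biadditive_eqI[where F = "\<lambda>x y. free_eval S x y [:l:]" and
          G = "\<lambda>x y. smul [:- koszul i j:] (free_eval S y x (- [:l:] - [:0, 1:]))"])
      (simp_all only: free_eval_add_left free_eval_add_right smul_add skew_single)
  then show "lam_eval (free_lam_module par S) (act (free_lam_module par S) x y) [:l:] =
       [:- koszul i j:] \<odot>\<^bsub>free_lam_module par S\<^esub>
       lam_eval (free_lam_module par S) (act (free_lam_module par S) y x) (- [:l:] - [:0, 1:])"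
    by simp
next
  fix x y z i j l m
  assume "x \<in> part (free_lam_module par S) i" "y \<in> part (free_lam_module par S) j"
  then show "lam_eval (free_lam_module par S) (act (free_lam_module par S) x
        (lam_eval (free_lam_module par S) (act (free_lam_module par S) y z) [:m:])) [:l:] =
      lam_eval (free_lam_module par S) (act (free_lam_module par S)
        (lam_eval (free_lam_module par S) (act (free_lam_module par S) x y) [:l:]) z) [:l + m:]
      \<oplus>\<^bsub>free_lam_module par S\<^esub> [:koszul i j:] \<odot>\<^bsub>free_lam_module par S\<^esub>
      lam_eval (free_lam_module par S) (act (free_lam_module par S) y
        (lam_eval (free_lam_module par S) (act (free_lam_module par S) x z) [:l:])) [:m:]"
    using free_bracket_identity[of S S par x i y j l z m, OF basis] by simp
qed

lemma free_conformal_module: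
  assumes lie: "lie_conformal_superalgebra (free_lam_module parR SR)"
    and par: "\<And>a b c. c \<in> Poly_Mapping.keys (S a b) \<Longrightarrow> par c = parR a + par b"
    and basis: "\<And>a b c l m.
      free_eval S (basis_act SR a b [:l:]) (Poly_Mapping.single c 1) [:l + m:] =
        free_eval S (Poly_Mapping.single a 1) (basis_act S b c [:m:]) [:l:] -
        smul [:koszul (parR a) (parR b):] (free_eval S (Poly_Mapping.single b 1) (basis_act S a c [:l:]) [:m:])"
  shows "conformal_module (free_lam_module parR SR) (free_lam_module par S)"
proof (intro conformal_module.intro conformal_module_axioms.intro free_lambda_product par lie)
  fix x y v i j l m
  assume "x \<in> part (free_lam_module parR SR) i" "y \<in> part (free_lam_module parR SR) j"
  then show "lam_eval (free_lam_module par S) (act (free_lam_module par S)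
        (lam_eval (free_lam_module parR SR) (act (free_lam_module parR SR) x y) [:l:]) v) [:l + m:] =
      lam_eval (free_lam_module par S) (act (free_lam_module par S) x
        (lam_eval (free_lam_module par S) (act (free_lam_module par S) y v) [:m:])) [:l:]
      \<ominus>\<^bsub>free_lam_module par S\<^esub> [:koszul i j:] \<odot>\<^bsub>free_lam_module par S\<^esub>
      lam_eval (free_lam_module par S) (act (free_lam_module par S) y
        (lam_eval (free_lam_module par S) (act (free_lam_module par S) x v) [:l:])) [:m:]"
    using free_bracket_identity[of S SR parR x i y j l v m, OF basis] by (simp add: a_minus_def free_a_inv)
qed

section \<open>The Lie conformal superalgebra\<close>

lemma map_zero: "f 0 = 0 \<Longrightarrow> Poly_Mapping.map f 0 = 0"
  by (rule poly_mapping_eqI) (simp add: lookup_map')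

lemma single_eqI: "c = d \<Longrightarrow> Poly_Mapping.single k c = Poly_Mapping.single k d"
  by simp

lemma single_plus_eqI: "c = d \<Longrightarrow> Poly_Mapping.single k c + x = Poly_Mapping.single k d + (x :: 'a \<Rightarrow>\<^sub>0 complex poly)"
  by simp

lemma map_add:
  assumes "f 0 = 0" "\<And>q r. f (q + r) = f q + f r"
  shows "Poly_Mapping.map f (x + y) = Poly_Mapping.map f x + Poly_Mapping.map f y"
  by (rule poly_mapping_eqI) (simp add: lookup_map' assms lookup_add)

text \<open>In the rows filled in by skew-symmetry, substituting
  \<open>- \<lambda> - \<partial>\<close> changes the coefficient of \<partial>. For
  \<open>J i\<close> against \<open>L j\<close> it is \<open>(i + j + p) - (j + p) = i\<close>; for
  an odd generator against \<open>L j\<close> it is \<open>i + p / 2\<close>.\<close>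

lemma basis_act_kbracket:
  "basis_act (kbracket p) (L i) (L j) s =
    Poly_Mapping.single (L (i + j)) ([:0, of_nat i + p:] + smult (of_nat i + of_nat j + 2 * p) s)"
  "basis_act (kbracket p) (L i) (J j) s =
    Poly_Mapping.single (J (i + j)) ([:0, of_nat i + p:] + smult (of_nat i + of_nat j + p) s)"
  "basis_act (kbracket p) (L i) (Gp j) s =
    Poly_Mapping.single (Gp (i + j)) ([:0, of_nat i + p:] + smult (of_nat i + of_nat j + 3 / 2 * p) s)"
  "basis_act (kbracket p) (L i) (Gm j) s =
    Poly_Mapping.single (Gm (i + j)) ([:0, of_nat i + p:] + smult (of_nat i + of_nat j + 3 / 2 * p) s)"
  "basis_act (kbracket p) (J i) (L j) s =
    Poly_Mapping.single (J (i + j)) ([:0, of_nat i:] + smult (of_nat i + of_nat j + p) s)"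
  "basis_act (kbracket p) (J i) (J j) s = 0"
  "basis_act (kbracket p) (J i) (Gp j) s = Poly_Mapping.single (Gp (i + j)) [:1:]"
  "basis_act (kbracket p) (J i) (Gm j) s = Poly_Mapping.single (Gm (i + j)) [:- 1:]"
  "basis_act (kbracket p) (Gp i) (L j) s =
    Poly_Mapping.single (Gp (i + j)) ([:0, of_nat i + p / 2:] + smult (of_nat i + of_nat j + 3 / 2 * p) s)"
  "basis_act (kbracket p) (Gp i) (J j) s = Poly_Mapping.single (Gp (i + j)) [:- 1:]"
  "basis_act (kbracket p) (Gp i) (Gp j) s = 0"
  "basis_act (kbracket p) (Gp i) (Gm j) s =
    Poly_Mapping.single (J (i + j)) ([:0, 2 * of_nat i + p:] + smult (2 * (of_nat i + of_nat j + p)) s) +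
    Poly_Mapping.single (L (i + j)) [:2:]"
  "basis_act (kbracket p) (Gm i) (L j) s =
    Poly_Mapping.single (Gm (i + j)) ([:0, of_nat i + p / 2:] + smult (of_nat i + of_nat j + 3 / 2 * p) s)"
  "basis_act (kbracket p) (Gm i) (J j) s = Poly_Mapping.single (Gm (i + j)) [:1:]"
  "basis_act (kbracket p) (Gm i) (Gp j) s =
    Poly_Mapping.single (J (i + j)) (- [:0, 2 * of_nat i + p:] - smult (2 * (of_nat i + of_nat j + p)) s) +
    Poly_Mapping.single (L (i + j)) [:2:]"
  "basis_act (kbracket p) (Gm i) (Gm j) s = 0"
  by ((simp add: basis_act_def kbracket_skew_def koszul_def map_add pcompose_add poly_pcompose smult_add_right one_pCons numeral_poly
    map_zero add.commute[of j i] del: diff_pCons;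
    (rule single_eqI single_plus_eqI)?;
    (rule poly_eqI, simp add: coeff_pCons algebra_simps split: nat.split)?))+

lemma kbracket_parity:
  "c \<in> Poly_Mapping.keys (kbracket p a b) \<Longrightarrow> kgen_parity c = kgen_parity a + kgen_parity b"
  by (cases a; cases b)
    (auto simp: in_keys_iff kbracket_skew_def lookup_map' lookup_add lookup_single when_def split: if_splits)


lemma KK_lie_conformal_superalgebra: "lie_conformal_superalgebra (KK p)"
  unfolding KK_def
proof (rule free_lie_conformal_superalgebra)
  show "basis_act (kbracket p) a b [:l:] =
      smul [:- koszul (kgen_parity a) (kgen_parity b):] (basis_act (kbracket p) b a (- [:l:] - [:0, 1:]))" for a b l
    by (cases a; cases b)
      (simp_all add: basis_act_kbracket koszul_def smul_add add.commute)
  \<comment> \<open>With \<open>q = p/2\<close> no fractions remain, and \<open>algebra_simps\<close> decides the polynomial identities.\<close>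
  obtain q where p: "p = 2 * q" by (rule that[of "p / 2"]) simp
  show "free_eval (kbracket p) (basis_act (kbracket p) a b [:l:]) (Poly_Mapping.single c 1) [:l + m:] =
       free_eval (kbracket p) (Poly_Mapping.single a 1) (basis_act (kbracket p) b c [:m:]) [:l:] -
       smul [:koszul (kgen_parity a) (kgen_parity b):]
        (free_eval (kbracket p) (Poly_Mapping.single b 1) (basis_act (kbracket p) a c [:l:]) [:m:])" for a b c l m
    unfolding p
    \<comment> \<open>There are 64 triples of types of generators, with symbolic indices. Equations
      between single monomials reduce to their coefficients; what is left is compared
      coordinatewise.\<close>
    by (cases a; cases b; cases c;
      simp add: basis_act_kbracket koszul_def smul_add free_eval_single free_eval_add_left free_eval_add_right
        pcompose_pCons pcompose_1 add_ac smul_minus_left flip: single_add single_diff;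
      (rule single_eqI, simp)?; (simp add: algebra_simps; fail)?;
      (rule poly_mapping_eqI, simp add: lookup_add lookup_minus lookup_single when_def, (simp add: algebra_simps)?)?)
qed (rule kbracket_parity)

section \<open>The actions on the rank two modules\<close>

lemma basis_act_v1_action:
  "basis_act (v1_action p s \<Delta> \<alpha>) (L i) v0 t =
    (if i = 0 then Poly_Mapping.single v0 ([:p * \<alpha>, p:] + smult (p * \<Delta>) t) else 0)"
  "basis_act (v1_action p s \<Delta> \<alpha>) (L i) v1 t =
    (if i = 0 then Poly_Mapping.single v1 ([:p * \<alpha>, p:] + smult (p * \<Delta> + p / 2) t) else 0)"
  "basis_act (v1_action p s \<Delta> \<alpha>) (J i) v0 t = (if i = 0 then Poly_Mapping.single v0 [:- 2 * \<Delta>:] else 0)"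
  "basis_act (v1_action p s \<Delta> \<alpha>) (J i) v1 t = (if i = 0 then Poly_Mapping.single v1 [:1 - 2 * \<Delta>:] else 0)"
  "basis_act (v1_action p s \<Delta> \<alpha>) (Gp i) v0 t = (if i = 0 then Poly_Mapping.single v1 [:s:] else 0)"
  "basis_act (v1_action p s \<Delta> \<alpha>) (Gp i) v1 t = 0"
  "basis_act (v1_action p s \<Delta> \<alpha>) (Gm i) v0 t = 0"
  "basis_act (v1_action p s \<Delta> \<alpha>) (Gm i) v1 t =
    (if i = 0 then Poly_Mapping.single v0 ([:2 * s * \<alpha>, 2 * s:] + smult (4 * s * \<Delta>) t) else 0)"
  by (cases i; simp add: basis_act_def map_zero;
    (rule single_eqI, rule poly_eqI, simp add: coeff_pCons algebra_simps split: nat.split)?)+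

lemma basis_act_v2_action:
  "basis_act (v2_action p s \<Delta> \<alpha>) (L i) v0 t =
    (if i = 0 then Poly_Mapping.single v0 ([:p * \<alpha>, p:] + smult (p * \<Delta>) t) else 0)"
  "basis_act (v2_action p s \<Delta> \<alpha>) (L i) v1 t =
    (if i = 0 then Poly_Mapping.single v1 ([:p * \<alpha>, p:] + smult (p * \<Delta> + p / 2) t) else 0)"
  "basis_act (v2_action p s \<Delta> \<alpha>) (J i) v0 t = (if i = 0 then Poly_Mapping.single v0 [:2 * \<Delta>:] else 0)"
  "basis_act (v2_action p s \<Delta> \<alpha>) (J i) v1 t = (if i = 0 then Poly_Mapping.single v1 [:2 * \<Delta> - 1:] else 0)"
  "basis_act (v2_action p s \<Delta> \<alpha>) (Gp i) v0 t = 0"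
  "basis_act (v2_action p s \<Delta> \<alpha>) (Gp i) v1 t =
    (if i = 0 then Poly_Mapping.single v0 ([:2 * s * \<alpha>, 2 * s:] + smult (4 * s * \<Delta>) t) else 0)"
  "basis_act (v2_action p s \<Delta> \<alpha>) (Gm i) v0 t = (if i = 0 then Poly_Mapping.single v1 [:s:] else 0)"
  "basis_act (v2_action p s \<Delta> \<alpha>) (Gm i) v1 t = 0"
  by (cases i; simp add: basis_act_def map_zero;
    (rule single_eqI, rule poly_eqI, simp add: coeff_pCons algebra_simps split: nat.split)?)+

lemma v1_action_parity:
  "c \<in> Poly_Mapping.keys (v1_action p s \<Delta> \<alpha> a b) \<Longrightarrow> vgen_parity c = kgen_parity a + vgen_parity b"
  by (induction p s \<Delta> \<alpha> a b rule: v1_action.induct) (auto simp: in_keys_iff lookup_single when_def split: if_splits)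

lemma v2_action_parity:
  "c \<in> Poly_Mapping.keys (v2_action p s \<Delta> \<alpha> a b) \<Longrightarrow> vgen_parity c = kgen_parity a + vgen_parity b"
  by (induction p s \<Delta> \<alpha> a b rule: v2_action.induct) (auto simp: in_keys_iff lookup_single when_def split: if_splits)

lemma V1_conformal_module:
  assumes "s\<^sup>2 = p"
  shows "conformal_module (KK p) (V1 p s \<Delta> \<alpha>)"
  unfolding KK_def V1_def
proof (rule free_conformal_module)
  obtain q where p: "p = 2 * q" by (rule that[of "p / 2"]) simp
  \<comment> \<open>Two odd generators acting in succession produce \<open>s * s\<close>; here it
    enters that \<open>s\<close> is a square root of \<open>p\<close>. As before,
    \<open>q = p/2\<close> avoids fractions.\<close>
  have s: "s * s = 2 * q" "s * (s * x) = 2 * (q * x)" for x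
    using assms by (simp_all add: p power2_eq_square flip: mult.assoc)
  show "free_eval (v1_action p s \<Delta> \<alpha>) (basis_act (kbracket p) a b [:l:]) (Poly_Mapping.single c 1) [:l + m:] =
       free_eval (v1_action p s \<Delta> \<alpha>) (Poly_Mapping.single a 1)
        (basis_act (v1_action p s \<Delta> \<alpha>) b c [:m:]) [:l:] -
       smul [:koszul (kgen_parity a) (kgen_parity b):]
        (free_eval (v1_action p s \<Delta> \<alpha>) (Poly_Mapping.single b 1)
          (basis_act (v1_action p s \<Delta> \<alpha>) a c [:l:]) [:m:])" for a b c l m
    unfolding p by (cases a; cases b; cases c;
      simp add: basis_act_kbracket basis_act_v1_action koszul_def smul_add free_eval_single free_eval_add_left
        free_eval_add_right pcompose_pCons pcompose_1 add_ac smul_minus_left flip: single_add single_diff single_uminus;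
      (intro impI)?; (rule single_eqI)?; (simp add: algebra_simps s; fail)?)
qed (use KK_lie_conformal_superalgebra v1_action_parity in \<open>auto simp: KK_def\<close>)

lemma V2_conformal_module:
  assumes "s\<^sup>2 = p"
  shows "conformal_module (KK p) (V2 p s \<Delta> \<alpha>)"
  unfolding KK_def V2_def
proof (rule free_conformal_module)
  obtain q where p: "p = 2 * q" by (rule that[of "p / 2"]) simp
  have s: "s * s = 2 * q" "s * (s * x) = 2 * (q * x)" for x
    using assms by (simp_all add: p power2_eq_square flip: mult.assoc)
  show "free_eval (v2_action p s \<Delta> \<alpha>) (basis_act (kbracket p) a b [:l:]) (Poly_Mapping.single c 1) [:l + m:] =
       free_eval (v2_action p s \<Delta> \<alpha>) (Poly_Mapping.single a 1)
        (basis_act (v2_action p s \<Delta> \<alpha>) b c [:m:]) [:l:] -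
       smul [:koszul (kgen_parity a) (kgen_parity b):]
        (free_eval (v2_action p s \<Delta> \<alpha>) (Poly_Mapping.single b 1)
          (basis_act (v2_action p s \<Delta> \<alpha>) a c [:l:]) [:m:])" for a b c l m
    unfolding p by (cases a; cases b; cases c;
      simp add: basis_act_kbracket basis_act_v2_action koszul_def smul_add free_eval_single free_eval_add_left
        free_eval_add_right pcompose_pCons pcompose_1 add_ac smul_minus_left flip: single_add single_diff single_uminus;
      (intro impI)?; (rule single_eqI)?; (simp add: algebra_simps s; fail)?)
qed (use KK_lie_conformal_superalgebra v2_action_parity in \<open>auto simp: KK_def\<close>)

section \<open>Submodules of the rank two modules\<close>

text \<open>By sesquilinearity, compatibility on generators and basis vectors extends to all
  \<open>x\<close> and \<open>v\<close> at every complex value of \<lambda>. Values determine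
  coefficients, so it holds for each power of \<lambda>.\<close>

lemma free_hom_act:
  fixes S :: "'a \<Rightarrow> 'b \<Rightarrow> ('b \<Rightarrow>\<^sub>0 complex poly poly)"
    and S' :: "'a \<Rightarrow> 'c \<Rightarrow> ('c \<Rightarrow>\<^sub>0 complex poly poly)"
  assumes add: "\<And>v w. \<psi> (v + w) = \<psi> v + \<psi> w"
    and smul: "\<And>f v. \<psi> (smul f v) = smul f (\<psi> v)"
    and basis: "\<And>a b l. \<psi> (basis_act S a b [:l:]) =
      free_eval S' (Poly_Mapping.single a 1) (\<psi> (Poly_Mapping.single b 1)) [:l:]"
  shows "\<psi> (free_act S x v n) = free_act S' x (\<psi> v) n"
proof -
  have zero: "\<psi> 0 = 0" using add[of 0 0] by simp
  have sum: "\<psi> (\<Sum>n\<in>A. h n) = (\<Sum>n\<in>A. \<psi> (h n))" for h and A :: "nat set"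
    by (induction A rule: infinite_finite_induct) (simp_all add: zero add)
  have eval: "\<psi> (free_eval S x v [:l:]) = free_eval S' x (\<psi> v) [:l:]" for l
  proof (rule biadditive_eqI[where P = "\<lambda>_. True" and Q = "\<lambda>_. True" and
        F = "\<lambda>x v. \<psi> (free_eval S x v [:l:])" and G = "\<lambda>x v. free_eval S' x (\<psi> v) [:l:]"])
    fix a :: 'a and b :: 'b and f g :: "complex poly"
    have "Poly_Mapping.single a f = smul f (Poly_Mapping.single a 1)"
      "Poly_Mapping.single b g = smul g (Poly_Mapping.single b 1)"
      by simp_all
    then have "free_eval S' (Poly_Mapping.single a f) (\<psi> (Poly_Mapping.single b g)) [:l:] =
        smul (pcompose f (- [:l:])) (smul (pcompose g ([:0, 1:] + [:l:]))
          (free_eval S' (Poly_Mapping.single a 1) (\<psi> (Poly_Mapping.single b 1)) [:l:]))"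
      by (metis smul free_eval_smul_left free_eval_smul_right)
    then show "\<psi> (free_eval S (Poly_Mapping.single a f) (Poly_Mapping.single b g) [:l:]) =
        free_eval S' (Poly_Mapping.single a f) (\<psi> (Poly_Mapping.single b g)) [:l:]"
      by (simp add: free_eval_single smul basis)
  qed (simp_all add: free_eval_add_left free_eval_add_right add)
  have fin: "finite {n. \<psi> (free_act S x v n) \<noteq> 0}"
    by (rule finite_subset[OF _ finite_free_act[of S x v]]) (auto simp: zero)
  \<comment> \<open>Parity and action are irrelevant for \<open>lam_eval\<close>, hence \<open>undefined\<close>.\<close>
  have "(\<lambda>n. \<psi> (free_act S x v n)) = free_act S' x (\<psi> v)"
  proof (rule lam_eval_free_inj[OF fin finite_free_act])
    fix l
    \<comment> \<open>Since \<open>\<psi>\<close> may kill coefficients, the sum is first enlarged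
      to the support before \<open>\<psi>\<close> is applied; then linearity moves
      \<open>\<psi>\<close> outside.\<close>
    have "lam_eval (free_lam_module undefined undefined) (\<lambda>n. \<psi> (free_act S x v n)) [:l:] =
        (\<Sum>n\<in>{n. free_act S x v n \<noteq> 0}. smul ([:l:] ^ n) (\<psi> (free_act S x v n)))"
      unfolding lam_eval_free[OF fin]
      by (rule sum.mono_neutral_left) (auto simp: finite_free_act zero)
    also have "\<dots> = \<psi> (lam_eval (free_lam_module undefined undefined) (free_act S x v) [:l:])"
      by (simp only: lam_eval_free[OF finite_free_act] sum smul)
    finally show "lam_eval (free_lam_module undefined undefined) (\<lambda>n. \<psi> (free_act S x v n)) [:l:] =
        lam_eval (free_lam_module undefined undefined) (free_act S' x (\<psi> v)) [:l:]"
      by (simp only: lam_eval_free_act eval)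
  qed
  then show ?thesis by (rule fun_cong)
qed

section \<open>The distinguished subspace and its quotient\<close>

lemma velem_decomp:
  "x = Poly_Mapping.single v0 (Poly_Mapping.lookup x v0) + Poly_Mapping.single v1 (Poly_Mapping.lookup x v1)"
proof (rule poly_mapping_eqI)
  fix k show "Poly_Mapping.lookup x k = Poly_Mapping.lookup (Poly_Mapping.single v0 (Poly_Mapping.lookup x v0) +
    Poly_Mapping.single v1 (Poly_Mapping.lookup x v1)) k"
    by (cases k) (simp_all add: lookup_add lookup_single)
qed

lemma vgen_all: "(\<forall>b. P b) \<longleftrightarrow> P v0 \<and> P v1"
  by (metis vgen.exhaust)

lemma part_velem:
  "(\<forall>b\<in>Poly_Mapping.keys x. vgen_parity b = 0) \<longleftrightarrow> Poly_Mapping.lookup x v1 = 0"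
  "(\<forall>b\<in>Poly_Mapping.keys x. vgen_parity b = 1) \<longleftrightarrow> Poly_Mapping.lookup x v0 = 0"
  unfolding Ball_def vgen_all by (simp_all add: in_keys_iff)

text \<open>As 1/2 is invertible, the second summand contains every multiple of \<open>v1\<close>,
  so membership only constrains the \<open>v0\<close>-coordinate.\<close>

lemma sub_space_free:
  "sub_space (free_lam_module par S) \<alpha> = {x. [:\<alpha>, 1:] dvd Poly_Mapping.lookup x v0}"
proof (intro equalityI subsetI)
  fix x assume "x \<in> sub_space (free_lam_module par S) \<alpha>"
  then show "x \<in> {x. [:\<alpha>, 1:] dvd Poly_Mapping.lookup x v0}"
    by (auto simp: sub_space_def cyclic_span_def set_add_eq lookup_add lookup_single simp del: mult_pCons_right)
next
  fix x assume "x \<in> {x. [:\<alpha>, 1:] dvd Poly_Mapping.lookup x v0}"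
  then obtain f where f: "Poly_Mapping.lookup x v0 = [:\<alpha>, 1:] * f" by (auto elim: dvdE)
  have "x = smul f (Poly_Mapping.single v0 [:\<alpha>, 1:]) +
      smul ([:2:] * Poly_Mapping.lookup x v1) (Poly_Mapping.single v1 [:1 / 2:])"
    by (subst velem_decomp[of x]) (simp add: f algebra_simps)
  then show "x \<in> sub_space (free_lam_module par S) \<alpha>"
    unfolding sub_space_def cyclic_span_def set_add_eq free_lam_module_simps by blast
qed

text \<open>A divisor free of \<lambda> divides every coefficient of a polynomial in \<lambda>, so
  divisibility of the table entries passes to the whole action.\<close>

lemma free_act_dvd:
  assumes "\<And>a b. [:g:] dvd Poly_Mapping.lookup (S a b) c"
  shows "g dvd Poly_Mapping.lookup (free_act S x v n) c"
proof -
  have "[:g:] dvd free_gf S x v c"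
    unfolding free_gf_def by (intro dvd_sum dvd_mult assms)
  then show ?thesis by (simp add: lookup_free_act const_poly_dvd_iff)
qed

text \<open>By \<open>dvd\<close> the action maps the whole module into the subspace, which gives
  invariance. The vector \<open>v1\<close> shows that it is nonzero, and \<open>v0\<close> that it
  is proper, since \<partial>+\<alpha> does not divide 1.\<close>

lemma sub_space_nontrivial:
  assumes M: "conformal_module R (free_lam_module vgen_parity S)"
    and dvd: "\<And>a b. [:[:\<alpha>, 1:]:] dvd Poly_Mapping.lookup (S a b) v0"
  shows "nontrivial_submodule R (free_lam_module vgen_parity S) (sub_space (free_lam_module vgen_parity S) \<alpha>)"
proof -
  let ?M = "free_lam_module vgen_parity S" and ?N = "{x. [:\<alpha>, 1:] dvd Poly_Mapping.lookup x v0}"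
  interpret conformal_module R ?M by fact
  have "conformal_submodule R ?M ?N"
  proof (intro conformal_submodule.intro conformal_submodule_axioms.intro M submodule.intro subgroup.intro
      submodule_axioms.intro)
    show "inv\<^bsub>add_monoid ?M\<^esub> x \<in> ?N" if "x \<in> ?N" for x
      using that free_a_inv[of vgen_parity S x] by (simp add: a_inv_def)
    show "(?N \<inter> part ?M 0) <+>\<^bsub>?M\<^esub> (?N \<inter> part ?M 1) = ?N"
    proof (intro equalityI subsetI)
      fix x assume "x \<in> ?N"
      moreover note velem_decomp[of x]
      ultimately show "x \<in> (?N \<inter> part ?M 0) <+>\<^bsub>?M\<^esub> (?N \<inter> part ?M 1)"
        unfolding set_add_eq free_lam_module_simps part_velem
        by (intro CollectI exI[of _ "Poly_Mapping.single v0 (Poly_Mapping.lookup x v0)"]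
            exI[of _ "Poly_Mapping.single v1 (Poly_Mapping.lookup x v1)"]) (simp add: lookup_single)
    qed (auto simp: set_add_eq lookup_add)
  qed (simp_all add: lookup_add free_act_dvd dvd)
  moreover have "Poly_Mapping.single v1 1 \<in> ?N" "Poly_Mapping.single v1 1 \<noteq> (0 :: velem)"
    by (simp_all add: lookup_single flip: keys_eq_empty)
  then have "?N \<noteq> {0}" by auto
  moreover have "Poly_Mapping.single v0 1 \<notin> ?N"
    using dvd_imp_degree_le[of "[:\<alpha>, 1:]" 1] by auto
  then have "?N \<noteq> UNIV" by blast
  ultimately show ?thesis
    by (simp add: nontrivial_submodule_def sub_space_free)
qed

text \<open>Evaluating the \<open>v0\<close>-coordinate at -\<alpha> annihilates the result of every
  action and turns \<partial> into multiplication by -\<alpha>. Its kernel is the subspace, so the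
  first isomorphism theorem applies.\<close>

lemma sub_space_quotient:
  assumes M: "conformal_module R (free_lam_module vgen_parity S)"
    and dvd: "\<And>a b. [:[:\<alpha>, 1:]:] dvd Poly_Mapping.lookup (S a b) v0"
  shows "module_iso R (quotmod (free_lam_module vgen_parity S) (sub_space (free_lam_module vgen_parity S) \<alpha>))
    (trivial_module (- \<alpha>))"
proof -
  have dvd_iff: "[:\<alpha>, 1:] dvd f \<longleftrightarrow> poly f (- \<alpha>) = 0" for f
    by (simp add: poly_eq_0_iff_dvd)
  interpret conformal_module R "free_lam_module vgen_parity S" by fact
  interpret conformal_image R "free_lam_module vgen_parity S" "trivial_module (- \<alpha>)"
    "\<lambda>v. poly (Poly_Mapping.lookup v v0) (- \<alpha>)"
  proof
    have "z \<in> range (\<lambda>v. poly (Poly_Mapping.lookup v v0) (- \<alpha>))" for z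
      by (rule image_eqI[of _ _ "Poly_Mapping.single v0 [:z:]"]) (simp_all add: lookup_single)
    then show "carrier (trivial_module (- \<alpha>)) =
        (\<lambda>v. poly (Poly_Mapping.lookup v v0) (- \<alpha>)) ` carrier (free_lam_module vgen_parity S)"
      by (auto simp: trivial_module_def)
    show "part (trivial_module (- \<alpha>)) i =
        (\<lambda>v. poly (Poly_Mapping.lookup v v0) (- \<alpha>)) ` part (free_lam_module vgen_parity S) i" for i
    proof (cases i)
      case zero
      have "z \<in> (\<lambda>v. poly (Poly_Mapping.lookup v v0) (- \<alpha>)) ` {x. Poly_Mapping.lookup x v1 = 0}" for z
        by (rule image_eqI[of _ _ "Poly_Mapping.single v0 [:z:]"]) (simp_all add: lookup_single)
      then show ?thesis using zero by (auto simp: trivial_module_def part_velem)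
    next
      case one
      then show ?thesis by (auto simp: trivial_module_def part_velem intro!: image_eqI[of _ _ 0])
    qed
    show "poly (Poly_Mapping.lookup (act (free_lam_module vgen_parity S) a v n) v0) (- \<alpha>) =
        act (trivial_module (- \<alpha>)) a (poly (Poly_Mapping.lookup v v0) (- \<alpha>)) n" for a v n
      using free_act_dvd[OF dvd] by (simp add: trivial_module_def dvd_iff)
  qed (simp_all add: trivial_module_def lookup_add)
  show ?thesis
    by (rule quotient_module_iso) (simp add: sub_space_free dvd_iff trivial_module_def)
qed

text \<open>The generators \<open>u\<close> and \<open>d\<close>, which lead from \<open>v0\<close>
  to \<open>v1\<close> and back, are kept abstract, so that one argument serves both families, in
  which \<open>Gp 0\<close> and \<open>Gm 0\<close> exchange these roles.\<close>

lemma submodule_rank_two: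
  assumes sub: "conformal_submodule (free_lam_module parR SR) (free_lam_module vgen_parity S) N"
    and nonzero: "N \<noteq> {0}" and s: "s \<noteq> 0"
    and up: "S u v0 = Poly_Mapping.single v1 (Cst s)"
    and down: "S d v1 = Poly_Mapping.single v0 (Cst (2 * s) * (Del + Cst (2 * \<Delta>) * Lam + Cst \<alpha>))"
  shows "N = UNIV \<or> \<Delta> = 0 \<and> N = {x. [:\<alpha>, 1:] dvd Poly_Mapping.lookup x v0}"
proof -
  let ?e = "Poly_Mapping.single :: vgen \<Rightarrow> complex poly \<Rightarrow> velem"
  interpret conformal_submodule "free_lam_module parR SR" "free_lam_module vgen_parity S" N by fact
  have add: "x + y \<in> N" if "x \<in> N" "y \<in> N" for x y
    using m_closed that by simp
  have smul: "smul f x \<in> N" if "x \<in> N" for f x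
    using smult_closed that by simp
  have act: "free_act S x v n \<in> N" if "v \<in> N" for x v n
    using act_invariant that by simp
  have component: "?e v0 (Poly_Mapping.lookup x v0) \<in> N" "?e v1 (Poly_Mapping.lookup x v1) \<in> N" if "x \<in> N" for x
  proof -
    from that have "x \<in> (N \<inter> part (free_lam_module vgen_parity S) 0) <+>\<^bsub>free_lam_module vgen_parity S\<^esub>
        (N \<inter> part (free_lam_module vgen_parity S) 1)"
      by (simp only: graded)
    then obtain y z where "y \<in> N" "z \<in> N" "x = y + z"
      and "Poly_Mapping.lookup y v1 = 0" "Poly_Mapping.lookup z v0 = 0"
      unfolding set_add_eq free_lam_module_simps part_velem by auto
    then show "?e v0 (Poly_Mapping.lookup x v0) \<in> N" "?e v1 (Poly_Mapping.lookup x v1) \<in> N"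
      using velem_decomp[of y] velem_decomp[of z] by (simp_all add: lookup_add)
  qed
  have scale: "?e b 1 \<in> N" if "?e b [:c:] \<in> N" "c \<noteq> 0" for b c
    using smul[OF that(1), of "[:1 / c:]"] that(2) by (simp add: one_pCons)
  have raise: "?e v1 1 \<in> N" if f: "?e v0 f \<in> N" "f \<noteq> 0" for f
  proof (rule scale)
    \<comment> \<open>The action of \<open>u\<close> yields
      \<open>s f(\<partial>+\<lambda>) v1\<close>, whose top coefficient in \<lambda> is a constant
      multiple of \<open>v1\<close>.\<close>
    have "free_act S (Poly_Mapping.single u 1) (?e v0 f) (Polynomial.degree f) = ?e v1 [:lead_coeff f * s:]"
      using subst_del_Del_Lam[OF f(2)] by (simp add: free_act_single up mult.commute)
    with act[OF f(1)] show "?e v1 [:lead_coeff f * s:] \<in> N" by metis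
    show "lead_coeff f * s \<noteq> 0" using f s by simp
  qed
  have Q: "Cst (2 * s) * (Del + Cst (2 * \<Delta>) * Lam + Cst \<alpha>) = [:[:2 * s * \<alpha>, 2 * s:], [:4 * s * \<Delta>:]:]"
    by simp
  have lower: "?e v0 (if \<Delta> = 0 then [:\<alpha>, 1:] else 1) \<in> N" if g: "?e v1 g \<in> N" "g \<noteq> 0" for g
  proof -
    let ?g = "subst_del g (Del + Lam)" and ?Q = "[:[:2 * s * \<alpha>, 2 * s:], [:4 * s * \<Delta>:]:]"
    have act_g: "?e v0 (Polynomial.coeff (?g * ?Q) n) \<in> N" for n
      using act[OF g(1), of "Poly_Mapping.single d 1" n] by (simp only: free_act_single down Q) simp
    have lc: "lead_coeff ?g = [:lead_coeff g:]"
      using g by (intro subst_del_Del_Lam)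
    \<comment> \<open>The degree of \<open>?Q\<close> in \<lambda> depends on \<Delta>: the leading
      coefficient is the constant \<open>4 s \<Delta>\<close> if \<Delta> is nonzero, and
      \<open>2 s (\<partial>+\<alpha>)\<close> otherwise. This produces the two cases of
      \<open>lower\<close>.\<close>
    have top: "?e v0 ([:lead_coeff g:] * lead_coeff ?Q) \<in> N"
      using act_g[of "Polynomial.degree ?g + Polynomial.degree ?Q"] by (simp only: coeff_mult_degree_sum lc)
    show ?thesis
    proof (cases "\<Delta> = 0")
      case True
      then show ?thesis
        using smul[OF top, of "[:1 / (lead_coeff g * 2 * s):]"] g s by simp
    next
      case False
      then show ?thesis
        using scale[of v0 "4 * s * \<Delta> * lead_coeff g"] top g s by simp
    qed
  qed
  from nonzero obtain x where x: "x \<in> N" "x \<noteq> 0"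
    using one_closed by auto
  have v1: "?e v1 1 \<in> N"
  proof (cases "Poly_Mapping.lookup x v0 = 0")
    case True
    with x have "Poly_Mapping.lookup x v1 \<noteq> 0"
      using velem_decomp[of x] by auto
    \<comment> \<open>Going down to a nonzero multiple of \<open>v0\<close> and up again gives
      \<open>v1\<close> from an arbitrary odd element.\<close>
    from lower[OF component(2)[OF x(1)] this] show ?thesis
      by (rule raise) simp
  next
    case False
    with component(1)[OF x(1)] show ?thesis by (rule raise)
  qed
  have full: "N = UNIV" if "?e v0 1 \<in> N"
  proof -
    have "y \<in> N" for y
      using add[OF smul[OF that, of "Poly_Mapping.lookup y v0"] smul[OF v1, of "Poly_Mapping.lookup y v1"]]
        velem_decomp[of y] by simp
    then show ?thesis by blast
  qed
  have v0: "?e v0 (if \<Delta> = 0 then [:\<alpha>, 1:] else 1) \<in> N"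
    using lower[OF v1] by simp
  show ?thesis
  proof (cases "\<Delta> = 0")
    case False
    with v0 full show ?thesis by simp
  next
    case True
    let ?K = "{x. [:\<alpha>, 1:] dvd Poly_Mapping.lookup x v0}"
    have "?K \<subseteq> N"
    proof
      fix y assume "y \<in> ?K"
      then obtain f where f: "Poly_Mapping.lookup y v0 = f * [:\<alpha>, 1:]"
        by (auto elim: dvdE simp: mult.commute)
      have "smul f (?e v0 [:\<alpha>, 1:]) + smul (Poly_Mapping.lookup y v1) (?e v1 1) \<in> N"
        using v0 v1 True by (intro add smul) simp_all
      then show "y \<in> N"
        using velem_decomp[of y] f by simp
    qed
    moreover have "N = UNIV" if "y \<in> N" "y \<notin> ?K" for y
    proof -
      let ?f = "Poly_Mapping.lookup y v0"
      have c: "poly ?f (- \<alpha>) \<noteq> 0"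
        using that(2) by (simp add: poly_eq_0_iff_dvd)
      \<comment> \<open>Modulo \<partial>+\<alpha> the coordinate equals its value at -\<alpha>. The
        difference already lies in \<open>N\<close>, so a nonzero constant multiple of
        \<open>v0\<close> does too, and this generates everything.\<close>
      have "[:\<alpha>, 1:] dvd [:poly ?f (- \<alpha>):] - ?f"
        using poly_eq_0_iff_dvd[of "[:poly ?f (- \<alpha>):] - ?f" "- \<alpha>"] by simp
      with \<open>?K \<subseteq> N\<close> have "?e v0 ([:poly ?f (- \<alpha>):] - ?f) \<in> N"
        by (auto simp: lookup_single)
      from add[OF this component(1)[OF that(1)]] have "?e v0 [:poly ?f (- \<alpha>):] \<in> N"
        by (simp flip: single_add)
      then show ?thesis using c by (intro full scale)
    qed
    ultimately show ?thesis using True by blast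
  qed
qed

lemma simple_module_rank_two:
  assumes M: "conformal_module (free_lam_module parR SR) (free_lam_module vgen_parity S)"
    and "s \<noteq> 0" "\<Delta> \<noteq> 0"
    and "S u v0 = Poly_Mapping.single v1 (Cst s)"
    and "S d v1 = Poly_Mapping.single v0 (Cst (2 * s) * (Del + Cst (2 * \<Delta>) * Lam + Cst \<alpha>))"
  shows "simple_module (free_lam_module parR SR) (free_lam_module vgen_parity S)"
proof -
  have "Poly_Mapping.single v0 1 \<noteq> (0 :: velem)"
    by (simp flip: keys_eq_empty)
  then have "(UNIV :: velem set) \<noteq> {0}" by blast
  then show ?thesis
    using submodule_rank_two[of parR SR S _ s u d \<Delta> \<alpha>] assms
    by (auto simp: simple_module_def nontrivial_submodule_def)
qed

lemma nontrivial_submodule_rank_two: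
  assumes M: "conformal_module (free_lam_module parR SR) (free_lam_module vgen_parity S)"
    and "s \<noteq> 0"
    and "S u v0 = Poly_Mapping.single v1 (Cst s)"
    and "S d v1 = Poly_Mapping.single v0 (Cst (2 * s) * (Del + Cst (2 * 0) * Lam + Cst \<alpha>))"
    and dvd: "\<And>a b. [:[:\<alpha>, 1:]:] dvd Poly_Mapping.lookup (S a b) v0"
  shows "nontrivial_submodule (free_lam_module parR SR) (free_lam_module vgen_parity S) N \<longleftrightarrow>
    N = sub_space (free_lam_module vgen_parity S) \<alpha>"
  using submodule_rank_two[of parR SR S N s u d 0 \<alpha>] assms sub_space_nontrivial[OF M dvd]
  by (auto simp: nontrivial_submodule_def sub_space_free)

text \<open>At \<Delta> = 0 the eigenvalue of \<open>J 0\<close> on \<open>v0\<close> vanishes, and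
  the other entries into \<open>v0\<close>, from \<open>L 0\<close> and \<open>Gm 0\<close>, lose
  their \<lambda>-term and become constant multiples of \<partial>+\<alpha>.\<close>

lemma v1_action_dvd: "[:[:\<alpha>, 1:]:] dvd Poly_Mapping.lookup (v1_action p s 0 \<alpha> a b) v0"
proof -
  have "[:\<alpha>, 1:] dvd [:c * \<alpha>, c:]" for c
    by (rule dvdI[of _ _ "[:c:]"]) simp
  then show ?thesis
    by (cases "(p, s, 0 :: complex, \<alpha>, a, b)" rule: v1_action.cases) (simp_all add: lookup_single)
qed

lemma v2_action_dvd: "[:[:\<alpha>, 1:]:] dvd Poly_Mapping.lookup (v2_action p s 0 \<alpha> a b) v0"
proof -
  have "[:\<alpha>, 1:] dvd [:c * \<alpha>, c:]" for c
    by (rule dvdI[of _ _ "[:c:]"]) simp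
  then show ?thesis
    by (cases "(p, s, 0 :: complex, \<alpha>, a, b)" rule: v2_action.cases) (simp_all add: lookup_single)
qed

text \<open>The inverse of the isomorphism sought. It exchanges the basis vectors, whence the
  reversed parity, and sends them to the generators of the submodule. The factor 1/2 absorbs the 2
  in the actions of the odd generators.\<close>

definition sub_space_map :: "complex \<Rightarrow> velem \<Rightarrow> velem" where
  "sub_space_map \<alpha> w = Poly_Mapping.single v0 ([:\<alpha>, 1:] * Poly_Mapping.lookup w v1) +
    Poly_Mapping.single v1 ([:1 / 2:] * Poly_Mapping.lookup w v0)"

lemma lookup_sub_space_map:
  "Poly_Mapping.lookup (sub_space_map \<alpha> w) v0 = [:\<alpha>, 1:] * Poly_Mapping.lookup w v1"
  "Poly_Mapping.lookup (sub_space_map \<alpha> w) v1 = [:1 / 2:] * Poly_Mapping.lookup w v0"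
  by (simp_all add: sub_space_map_def lookup_add lookup_single)

lemma velem_eq_iff:
  fixes x y :: velem
  shows "x = y \<longleftrightarrow> Poly_Mapping.lookup x v0 = Poly_Mapping.lookup y v0 \<and> Poly_Mapping.lookup x v1 = Poly_Mapping.lookup y v1"
  by (metis velem_decomp)

lemma sub_space_map_add: "sub_space_map \<alpha> (v + w) = sub_space_map \<alpha> v + sub_space_map \<alpha> w"
  by (simp only: velem_eq_iff lookup_sub_space_map lookup_add distrib_left simp_thms)

lemma sub_space_map_smul: "sub_space_map \<alpha> (smul f v) = smul f (sub_space_map \<alpha> v)"
  by (simp only: velem_eq_iff lookup_sub_space_map lookup_smul mult.left_commute simp_thms)

lemma inj_sub_space_map: "inj (sub_space_map \<alpha>)"
  by (rule injI) (simp only: velem_eq_iff lookup_sub_space_map mult_cancel_left, simp)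

lemma sub_space_map_surj:
  assumes "[:\<alpha>, 1:] dvd Poly_Mapping.lookup x v0"
  obtains w where "x = sub_space_map \<alpha> w"
proof -
  from assms obtain f where "Poly_Mapping.lookup x v0 = [:\<alpha>, 1:] * f"
    by (rule dvdE)
  then have "x = sub_space_map \<alpha> (Poly_Mapping.single v0 ([:2:] * Poly_Mapping.lookup x v1) + Poly_Mapping.single v1 f)"
    by (simp add: velem_eq_iff lookup_sub_space_map lookup_add lookup_single)
  then show ?thesis by (rule that)
qed

text \<open>\<open>sub_space_map\<close> is injective with the submodule as its range, so the
  submodule is presented as an image of the parity-reversed free module and inherits its module
  structure from there.\<close>

lemma sub_space_iso:
  assumes M': "conformal_module R (free_lam_module vgen_parity S')"
    and basis: "\<And>a b l. sub_space_map \<alpha> (basis_act S' a b [:l:]) =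
      free_eval S (Poly_Mapping.single a 1) (sub_space_map \<alpha> (Poly_Mapping.single b 1)) [:l:]"
  shows "module_iso R (submod (free_lam_module vgen_parity S) (sub_space (free_lam_module vgen_parity S) \<alpha>))
    (parity_rev (free_lam_module vgen_parity S'))"
proof -
  let ?N = "submod (free_lam_module vgen_parity S) (sub_space (free_lam_module vgen_parity S) \<alpha>)"
  let ?M' = "parity_rev (free_lam_module vgen_parity S')"
  have N_simps: "carrier ?N = {x. [:\<alpha>, 1:] dvd Poly_Mapping.lookup x v0}" "zero ?N = 0" "add ?N = (+)"
    "module.smult ?N = smul" "act ?N = free_act S"
    "part ?N = (\<lambda>i. {x. [:\<alpha>, 1:] dvd Poly_Mapping.lookup x v0} \<inter> {x. \<forall>b\<in>Poly_Mapping.keys x. vgen_parity b = i})"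
    by (simp_all add: submod_def sub_space_free)
  have dvd: "[:\<alpha>, 1:] dvd Poly_Mapping.lookup (sub_space_map \<alpha> w) v0" for w
    by (simp only: lookup_sub_space_map dvd_triv_left)
  have range: "{x. [:\<alpha>, 1:] dvd Poly_Mapping.lookup x v0} \<inter> {x. P x} = sub_space_map \<alpha> ` {w. P (sub_space_map \<alpha> w)}" for P
  proof (intro equalityI subsetI)
    fix x assume x: "x \<in> {x. [:\<alpha>, 1:] dvd Poly_Mapping.lookup x v0} \<inter> {x. P x}"
    then obtain w where "x = sub_space_map \<alpha> w"
      using sub_space_map_surj[of \<alpha> x] by blast
    with x show "x \<in> sub_space_map \<alpha> ` {w. P (sub_space_map \<alpha> w)}" by blast
  qed (use dvd in blast)
  \<comment> \<open>A coordinate of the image vanishes exactly when the opposite coordinate of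
    \<open>w\<close> does, which flips the parity.\<close>
  have part: "(\<forall>b\<in>Poly_Mapping.keys (sub_space_map \<alpha> w). vgen_parity b = i) \<longleftrightarrow>
      (\<forall>b\<in>Poly_Mapping.keys w. vgen_parity b = i + 1)" for w i
    by (cases i) (simp_all only: part_velem lookup_sub_space_map add_0 one_add_one bit_2_eq_0 mult_eq_0_iff, simp_all)
  interpret conformal_image R ?M' ?N "sub_space_map \<alpha>"
  proof (intro conformal_image.intro conformal_image_axioms.intro conformal_module_parity_rev M')
    show "carrier ?N = sub_space_map \<alpha> ` carrier ?M'"
      using range[of "\<lambda>_. True"] by (simp add: N_simps)
    show "part ?N i = sub_space_map \<alpha> ` part ?M' i" for i
      by (simp add: N_simps range part)
    show "sub_space_map \<alpha> (act ?M' a v n) = act ?N a (sub_space_map \<alpha> v) n" for a v n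
      using free_hom_act[of "sub_space_map \<alpha>", OF sub_space_map_add sub_space_map_smul basis] by (simp add: N_simps)
    show "\<zero>\<^bsub>?N\<^esub> = sub_space_map \<alpha> \<zero>\<^bsub>?M'\<^esub>"
      by (simp add: N_simps velem_eq_iff lookup_sub_space_map)
    show "part ?N 0 \<inter> part ?N 1 = {\<zero>\<^bsub>?N\<^esub>}"
      by (auto simp: N_simps part_velem velem_eq_iff)
  qed (simp_all add: N_simps sub_space_map_add sub_space_map_smul)
  show ?thesis
    by (rule image_module_iso) (simp add: inj_sub_space_map)
qed

lemma sub_space_map_single:
  "sub_space_map \<alpha> (Poly_Mapping.single v0 f) = Poly_Mapping.single v1 ([:1 / 2:] * f)"
  "sub_space_map \<alpha> (Poly_Mapping.single v1 f) = Poly_Mapping.single v0 ([:\<alpha>, 1:] * f)"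
  "sub_space_map \<alpha> 0 = 0"
  by (simp_all add: velem_eq_iff lookup_sub_space_map lookup_single)

text \<open>The parameter 1/2 is visible in the even generators: at \<Delta> = 0 the weight of
  \<open>L 0\<close> is 1/2 on \<open>v1\<close> and, by the shift of \<partial>+\<alpha>, 1 on
  \<open>(\<partial>+\<alpha>) v0\<close>. Moreover \<open>J 0\<close> acts on \<open>v1\<close> by
  1, as it does on \<open>v0\<close> in the second family at 1/2.\<close>

lemma V1_sub_space_iso:
  assumes "s\<^sup>2 = p"
  shows "module_iso (KK p) (submod (V1 p s 0 \<alpha>) (sub_space (V1 p s 0 \<alpha>) \<alpha>)) (parity_rev (V2 p s (1 / 2) \<alpha>))"
  unfolding V1_def V2_def
proof (rule sub_space_iso)
  show "conformal_module (KK p) (free_lam_module vgen_parity (v2_action p s (1 / 2) \<alpha>))"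
    using V2_conformal_module[OF assms] by (simp add: V2_def)
  show "sub_space_map \<alpha> (basis_act (v2_action p s (1 / 2) \<alpha>) a b [:l:]) =
      free_eval (v1_action p s 0 \<alpha>) (Poly_Mapping.single a 1) (sub_space_map \<alpha> (Poly_Mapping.single b 1)) [:l:]" for a b l
    by (cases a; cases b; simp add: basis_act_v1_action basis_act_v2_action sub_space_map_single free_eval_single
        pcompose_pCons pcompose_1 one_pCons; (intro impI)?; (rule single_eqI)?; (simp add: algebra_simps)?)
qed

text \<open>Here \<open>J 0\<close> acts on \<open>v1\<close> by -1, which is its eigenvalue on
  \<open>v0\<close> in the first family at 1/2.\<close>

lemma V2_sub_space_iso:
  assumes "s\<^sup>2 = p"
  shows "module_iso (KK p) (submod (V2 p s 0 \<alpha>) (sub_space (V2 p s 0 \<alpha>) \<alpha>)) (parity_rev (V1 p s (1 / 2) \<alpha>))"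
  unfolding V1_def V2_def
proof (rule sub_space_iso)
  show "conformal_module (KK p) (free_lam_module vgen_parity (v1_action p s (1 / 2) \<alpha>))"
    using V1_conformal_module[OF assms] by (simp add: V1_def)
  show "sub_space_map \<alpha> (basis_act (v1_action p s (1 / 2) \<alpha>) a b [:l:]) =
      free_eval (v2_action p s 0 \<alpha>) (Poly_Mapping.single a 1) (sub_space_map \<alpha> (Poly_Mapping.single b 1)) [:l:]" for a b l
    by (cases a; cases b; simp add: basis_act_v1_action basis_act_v2_action sub_space_map_single free_eval_single
        pcompose_pCons pcompose_1 one_pCons; (intro impI)?; (rule single_eqI)?; (simp add: algebra_simps)?)
qed

lemma sub_space_parity_rev [simp]: "sub_space (parity_rev M) \<alpha> = sub_space M \<alpha>"
  by (simp add: sub_space_def cyclic_span_def)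

section \<open>Submodules and quotients of the two families\<close>

lemma V1_submodules:
  assumes "p \<noteq> 0" and "s\<^sup>2 = p"
  shows "simple_module (KK p) (V1 p s \<Delta> \<alpha>) \<longleftrightarrow> \<Delta> \<noteq> 0"
    and "nontrivial_submodule (KK p) (V1 p s 0 \<alpha>) N \<longleftrightarrow> N = sub_space (V1 p s 0 \<alpha>) \<alpha>"
proof -
  have s: "s \<noteq> 0" using assms by auto
  note M = V1_conformal_module[OF assms(2), unfolded KK_def V1_def]
  show nontrivial: "nontrivial_submodule (KK p) (V1 p s 0 \<alpha>) N \<longleftrightarrow> N = sub_space (V1 p s 0 \<alpha>) \<alpha>" for N
    unfolding KK_def V1_def
    by (rule nontrivial_submodule_rank_two[OF M s _ _ v1_action_dvd, where u = "Gp 0" and d = "Gm 0"]) simp_all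
  have "simple_module (KK p) (V1 p s \<Delta> \<alpha>)" if "\<Delta> \<noteq> 0"
    unfolding KK_def V1_def
    by (rule simple_module_rank_two[OF M s that, where u = "Gp 0" and d = "Gm 0"]) simp_all
  then show "simple_module (KK p) (V1 p s \<Delta> \<alpha>) \<longleftrightarrow> \<Delta> \<noteq> 0"
    using nontrivial by (auto simp: simple_module_def)
qed

lemma V2_submodules:
  assumes "p \<noteq> 0" and "s\<^sup>2 = p"
  shows "simple_module (KK p) (V2 p s \<Delta> \<alpha>) \<longleftrightarrow> \<Delta> \<noteq> 0"
    and "nontrivial_submodule (KK p) (V2 p s 0 \<alpha>) N \<longleftrightarrow> N = sub_space (V2 p s 0 \<alpha>) \<alpha>"
proof -
  have s: "s \<noteq> 0" using assms by auto
  note M = V2_conformal_module[OF assms(2), unfolded KK_def V2_def]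
  show nontrivial: "nontrivial_submodule (KK p) (V2 p s 0 \<alpha>) N \<longleftrightarrow> N = sub_space (V2 p s 0 \<alpha>) \<alpha>" for N
    unfolding KK_def V2_def
    by (rule nontrivial_submodule_rank_two[OF M s _ _ v2_action_dvd, where u = "Gm 0" and d = "Gp 0"]) simp_all
  have "simple_module (KK p) (V2 p s \<Delta> \<alpha>)" if "\<Delta> \<noteq> 0"
    unfolding KK_def V2_def
    by (rule simple_module_rank_two[OF M s that, where u = "Gm 0" and d = "Gp 0"]) simp_all
  then show "simple_module (KK p) (V2 p s \<Delta> \<alpha>) \<longleftrightarrow> \<Delta> \<noteq> 0"
    using nontrivial by (auto simp: simple_module_def)
qed

lemma V1_quotient:
  "s\<^sup>2 = p \<Longrightarrow> module_iso (KK p) (quotmod (V1 p s 0 \<alpha>) (sub_space (V1 p s 0 \<alpha>) \<alpha>)) (trivial_module (- \<alpha>))"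
  using V1_conformal_module[of s p 0 \<alpha>] unfolding V1_def by (intro sub_space_quotient v1_action_dvd)

lemma V2_quotient:
  "s\<^sup>2 = p \<Longrightarrow> module_iso (KK p) (quotmod (V2 p s 0 \<alpha>) (sub_space (V2 p s 0 \<alpha>) \<alpha>)) (trivial_module (- \<alpha>))"
  using V2_conformal_module[of s p 0 \<alpha>] unfolding V2_def by (intro sub_space_quotient v2_action_dvd)

theorem proposition4p10:
  fixes p s \<Delta> \<alpha> :: complex
  assumes "p \<noteq> 0" and "s\<^sup>2 = p"
  shows "(simple_module (KK p) (V1 p s \<Delta> \<alpha>) \<longleftrightarrow> \<Delta> \<noteq> 0)
    \<and> (\<forall>N. nontrivial_submodule (KK p) (V1 p s 0 \<alpha>) N \<longleftrightarrow> N = sub_space (V1 p s 0 \<alpha>) \<alpha>)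
    \<and> module_iso (KK p) (submod (V1 p s 0 \<alpha>) (sub_space (V1 p s 0 \<alpha>) \<alpha>))
        (parity_rev (V2 p s (1 / 2) \<alpha>))
    \<and> module_iso (KK p) (quotmod (V1 p s 0 \<alpha>) (sub_space (V1 p s 0 \<alpha>) \<alpha>))
        (trivial_module (- \<alpha>))

    \<and> (simple_module (KK p) (V2 p s \<Delta> \<alpha>) \<longleftrightarrow> \<Delta> \<noteq> 0)
    \<and> (\<forall>N. nontrivial_submodule (KK p) (V2 p s 0 \<alpha>) N \<longleftrightarrow> N = sub_space (V2 p s 0 \<alpha>) \<alpha>)
    \<and> module_iso (KK p) (submod (V2 p s 0 \<alpha>) (sub_space (V2 p s 0 \<alpha>) \<alpha>))
        (parity_rev (V1 p s (1 / 2) \<alpha>))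
    \<and> module_iso (KK p) (quotmod (V2 p s 0 \<alpha>) (sub_space (V2 p s 0 \<alpha>) \<alpha>))
        (trivial_module (- \<alpha>))

    \<and> (simple_module (KK p) (parity_rev (V1 p s \<Delta> \<alpha>)) \<longleftrightarrow> \<Delta> \<noteq> 0)
    \<and> (\<forall>N. nontrivial_submodule (KK p) (parity_rev (V1 p s 0 \<alpha>)) N \<longleftrightarrow>
          N = sub_space (parity_rev (V1 p s 0 \<alpha>)) \<alpha>)
    \<and> module_iso (KK p)
        (submod (parity_rev (V1 p s 0 \<alpha>)) (sub_space (parity_rev (V1 p s 0 \<alpha>)) \<alpha>))
        (V2 p s (1 / 2) \<alpha>)
    \<and> module_iso (KK p)
        (quotmod (parity_rev (V1 p s 0 \<alpha>)) (sub_space (parity_rev (V1 p s 0 \<alpha>)) \<alpha>))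
        (parity_rev (trivial_module (- \<alpha>)))

    \<and> (simple_module (KK p) (parity_rev (V2 p s \<Delta> \<alpha>)) \<longleftrightarrow> \<Delta> \<noteq> 0)
    \<and> (\<forall>N. nontrivial_submodule (KK p) (parity_rev (V2 p s 0 \<alpha>)) N \<longleftrightarrow>
          N = sub_space (parity_rev (V2 p s 0 \<alpha>)) \<alpha>)
    \<and> module_iso (KK p)
        (submod (parity_rev (V2 p s 0 \<alpha>)) (sub_space (parity_rev (V2 p s 0 \<alpha>)) \<alpha>))
        (V1 p s (1 / 2) \<alpha>)
    \<and> module_iso (KK p)
        (quotmod (parity_rev (V2 p s 0 \<alpha>)) (sub_space (parity_rev (V2 p s 0 \<alpha>)) \<alpha>))
        (parity_rev (trivial_module (- \<alpha>)))"
  \<comment> \<open>Reversal changes neither the submodules nor simplicity, and it commutes with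
    \<open>submod\<close> and \<open>quotmod\<close>. Reversing an isomorphism onto a reversed
    module cancels the reversal of its target.\<close>
  using V1_submodules[OF assms] V2_submodules[OF assms] V1_sub_space_iso[OF assms(2)] V2_sub_space_iso[OF assms(2)]
    V1_quotient[OF assms(2)] V2_quotient[OF assms(2)]
    module_iso_parity_rev[OF V1_sub_space_iso[OF assms(2)]] module_iso_parity_rev[OF V2_sub_space_iso[OF assms(2)]]
    module_iso_parity_rev[OF V1_quotient[OF assms(2)]] module_iso_parity_rev[OF V2_quotient[OF assms(2)]]
  by (simp add: submod_parity_rev quotmod_parity_rev)

end
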